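(* Let $K$ be a field of characteristic zero, $R=K[x_1,x_2,x_3]$, $s\ge 2$, and let $I=(L_0^2,L_1^{a_1},\dots,L_s^{a_s})$, where $L_0,\dots,L_s$ are general linear forms and $a_1,\dots,a_s$ are positive integers. Let $L$ be a general linear form. Then for all integers $d\ge1$ and $j$, the map $\times L^d:[R/I]_{j-d}\to[R/I]_j$ has maximal rank; that is, $R/I$ has the Strong Lefschetz Property.
   Context: A map has maximal rank if it is injective or surjective. "General" means in a suitable nonempty Zariski open set. *)

theory Defs
  imports Complex_Main "HOL-Library.Poly_Mapping"
begin

text \<open>Multivariate polynomials over 'a: finitely supported maps from exponent
vectors (nat =>0 nat, variable index to exponent) to coefficients.
Multiplication is the convolution product provided by Poly_Mapping.\<close>

type_synonym 'a mpoly = "(nat \<Rightarrow>\<^sub>0 nat) \<Rightarrow>\<^sub>0 'a"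

definition mp_var :: "nat \<Rightarrow> 'a::comm_ring_1 mpoly" where
  "mp_var i = Poly_Mapping.single (Poly_Mapping.single i 1) 1"

definition mp_const :: "'a::comm_ring_1 \<Rightarrow> 'a mpoly" where
  "mp_const c = Poly_Mapping.single 0 c"

definition mp_in_vars :: "nat \<Rightarrow> ((nat \<Rightarrow>\<^sub>0 nat) \<Rightarrow>\<^sub>0 'a::zero) \<Rightarrow> bool" where
  "mp_in_vars n p \<longleftrightarrow> (\<forall>m::nat \<Rightarrow>\<^sub>0 nat. m \<in> Poly_Mapping.keys p \<longrightarrow> Poly_Mapping.keys m \<subseteq> {..<n})"

definition mon_deg :: "(nat \<Rightarrow>\<^sub>0 nat) \<Rightarrow> nat" where
  "mon_deg m = (\<Sum>i\<in>Poly_Mapping.keys m. Poly_Mapping.lookup m i)"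

definition mp_eval :: "'a::comm_ring_1 mpoly \<Rightarrow> (nat \<Rightarrow> 'a) \<Rightarrow> 'a" where
  "mp_eval p v = (\<Sum>m\<in>Poly_Mapping.keys p. Poly_Mapping.lookup p m * (\<Prod>i\<in>Poly_Mapping.keys m. v i ^ Poly_Mapping.lookup m i))"

text \<open>The graded piece R_j of R = K[x_0,x_1,x_2] (variables indexed 0,1,2):
homogeneous forms of degree j (the zero polynomial for j < 0).\<close>
definition Rdeg :: "int \<Rightarrow> 'a::comm_ring_1 mpoly set" where
  "Rdeg j = {p. mp_in_vars 3 p \<and> (\<forall>m\<in>Poly_Mapping.keys p. int (mon_deg m) = j)}"

definition linform :: "(nat \<Rightarrow> 'a::comm_ring_1) \<Rightarrow> 'a mpoly" where
  "linform c = (\<Sum>i<3. mp_const (c i) * mp_var i)"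

definition gen_ideal :: "nat \<Rightarrow> (nat \<Rightarrow> 'a::comm_ring_1 mpoly) \<Rightarrow> 'a mpoly set" where
  "gen_ideal s g = {(\<Sum>k\<le>s. r k * g k) | r. \<forall>k\<le>s. mp_in_vars 3 (r k)}"

text \<open>Multiplication by F : [R/I]_(j-d) -> [R/I]_j (F of degree d) is injective,
resp. surjective, written out on representatives.\<close>
definition mult_inj :: "'a::comm_ring_1 mpoly set \<Rightarrow> 'a mpoly \<Rightarrow> int \<Rightarrow> int \<Rightarrow> bool" where
  "mult_inj I F d j \<longleftrightarrow> (\<forall>f\<in>Rdeg (j - d). F * f \<in> I \<longrightarrow> f \<in> I)"

definition mult_surj :: "'a::comm_ring_1 mpoly set \<Rightarrow> 'a mpoly \<Rightarrow> int \<Rightarrow> int \<Rightarrow> bool" where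
  "mult_surj I F d j \<longleftrightarrow> (\<forall>g\<in>Rdeg j. \<exists>f\<in>Rdeg (j - d). g - F * f \<in> I)"

definition max_rank :: "'a::comm_ring_1 mpoly set \<Rightarrow> 'a mpoly \<Rightarrow> int \<Rightarrow> int \<Rightarrow> bool" where
  "max_rank I F d j \<longleftrightarrow> mult_inj I F d j \<or> mult_surj I F d j"

end

theory Submission
  imports Defs "HOL-Computational_Algebra.Polynomial"
begin

text \<open>
  If \<open>L\<^sub>0 = x\<close>, a form modulo \<open>x\<^sup>2\<close> is a pair of binary forms of degrees \<open>j\<close> and \<open>j - 1\<close>. Put
  \<open>m\<^sub>k = j + 1 - a\<^sub>k\<close> for the \<open>k\<close> with \<open>a\<^sub>k \<le> j\<close>, where \<open>L\<close> itself is one more form with exponent \<open>d\<close>.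
  The multiples of \<open>L\<^sub>k\<close> to the power \<open>a\<^sub>k\<close> contribute a space of dimension \<open>2 m\<^sub>k - 1\<close> inside a space of
  dimension \<open>2 j + 1\<close>, and in general position these spaces are independent or span. If they span,
  multiplication by \<open>L\<^sup>d\<close> is surjective onto degree \<open>j\<close>; if they are independent, \<open>L\<^sup>d f \<in> I\<close> forces
  \<open>f \<in> (L\<^sub>0\<^sup>2)\<close>. Since maximal rank is an open condition, it suffices to exhibit one good position: the
  lines \<open>y - k z + c\<^sub>k x\<close> with \<open>c\<^sub>k \<in> {0, 1}\<close>, for which the claim splits into two Hermite interpolation
  problems on binary forms. Only finitely many pairs \<open>(d, j)\<close> matter, because \<open>I\<close> contains all forms of
  degree \<open>a\<^sub>1 + a\<^sub>2\<close>.
\<close>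

section \<open>Hermite interpolation for binary forms\<close>

text \<open>Modulo \<open>x^2\<close> a form of degree \<open>j\<close> has a constant layer of
  dimension \<open>j + 1\<close> and an \<open>x\<close>-layer of dimension \<open>j\<close>. The
  contribution \<open>2 m_k - 1\<close> of a line splits as \<open>m_k\<close> and
  \<open>m_k - 1\<close> over these layers if \<open>c_k = 0\<close>, but as \<open>m_k - 1\<close>
  and \<open>m_k\<close> if \<open>c_k = 1\<close>. With \<open>n\<close> lines, \<open>r\<close> of
  them having \<open>c_k = 0\<close>, and \<open>D\<close> the sum of all \<open>m_k - 1\<close>,
  the layers receive \<open>D + r\<close> and \<open>D + n - r\<close> dimensions; a suitable
  \<open>r\<close> puts both on the same side of \<open>j + 1\<close> and \<open>j\<close> as
  \<open>2 D + n\<close> is of \<open>2 j + 1\<close>. The obstacle lies in independence: with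
  arbitrary cofactors it always fails, because \<open>L_0^2\<close> times a power of
  \<open>L_k\<close> can be charged to either generator. The cofactors of all lines but
  \<open>L_0\<close> are therefore kept at \<open>x\<close>-degree at most 1. Modulo a general
  \<open>L_0^2\<close> that normal form is itself available only generically, so division by
  \<open>L_0^2\<close> is a further open condition.\<close>

definition deg_lt :: "'a::zero poly \<Rightarrow> nat \<Rightarrow> bool" where
  "deg_lt p n \<longleftrightarrow> (\<forall>i\<ge>n. coeff p i = 0)"

definition lin :: "'a::comm_ring_1 \<Rightarrow> 'a poly" where
  "lin t = [:- t, 1:]"

lemma poly_lin [simp]: "poly (lin t) u = u - t"
  by (simp add: lin_def)

lemma lin_neq_0 [simp]: "lin t \<noteq> 0"
  by (simp add: lin_def)

lemma degree_lin [simp]: "degree (lin t) = 1"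
  by (simp add: lin_def)

lemma lin_dvd_iff: "lin t dvd p \<longleftrightarrow> poly p t = 0"
  by (simp add: lin_def poly_eq_0_iff_dvd)

lemma pderiv_lin [simp]: "pderiv (lin t) = 1"
  by (simp add: lin_def pderiv_pCons)

lemma deg_lt_iff: "deg_lt p n \<longleftrightarrow> p = 0 \<or> degree p < n"
proof
  assume "deg_lt p n"
  then show "p = 0 \<or> degree p < n"
    by (metis deg_lt_def leading_coeff_0_iff not_less)
next
  assume "p = 0 \<or> degree p < n"
  then show "deg_lt p n" by (auto simp: deg_lt_def intro: coeff_eq_0)
qed

lemma deg_lt_0 [simp]: "deg_lt p 0 \<longleftrightarrow> p = 0"
  by (simp add: deg_lt_iff)

lemma deg_lt_zero [simp]: "deg_lt 0 n"
  by (simp add: deg_lt_def)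

lemma deg_lt_mono: "deg_lt p m \<Longrightarrow> m \<le> n \<Longrightarrow> deg_lt p n"
  by (simp add: deg_lt_def)

lemma deg_lt_add: "deg_lt p n \<Longrightarrow> deg_lt q n \<Longrightarrow> deg_lt (p + q) n"
  by (simp add: deg_lt_def)

lemma deg_lt_diff: "deg_lt p n \<Longrightarrow> deg_lt q n \<Longrightarrow> deg_lt (p - q) n"
  for p q :: "'a::ab_group_add poly"
  by (simp add: deg_lt_def)

lemma deg_lt_smult: "deg_lt p n \<Longrightarrow> deg_lt (smult c p) n"
  by (simp add: deg_lt_def)

lemma deg_lt_sum: "(\<And>i. i \<in> A \<Longrightarrow> deg_lt (f i) n) \<Longrightarrow> deg_lt (sum f A) n"
  by (simp add: deg_lt_def coeff_sum)

lemma deg_lt_const: "0 < n \<Longrightarrow> deg_lt [:c:] n"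
  by (simp add: deg_lt_iff)

lemma deg_lt_lin_mult: "deg_lt (lin t * p) (Suc n) \<longleftrightarrow> deg_lt p n"
  for p :: "'a::idom poly"
proof (cases "p = 0")
  case False
  then have "degree (lin t * p) = Suc (degree p)"
    by (subst degree_mult_eq) auto
  with False show ?thesis by (simp add: deg_lt_iff)
qed simp

lemma deg_lt_lin_power_mult: "deg_lt p n \<Longrightarrow> deg_lt (lin t ^ b * p) (b + n)"
  for p :: "'a::idom poly"
  by (induction b) (simp_all add: mult.assoc deg_lt_lin_mult)

lemma deg_lt_lin_power_mult': "deg_lt p n \<Longrightarrow> b + n \<le> m \<Longrightarrow> deg_lt (lin t ^ b * p) m"
  for p :: "'a::idom poly"
  using deg_lt_lin_power_mult deg_lt_mono by blast

lemma deg_lt_lin_power: "deg_lt (lin t ^ n) (Suc n)"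
  for t :: "'a::idom"
  using deg_lt_lin_power_mult[of 1 1 t n] by (simp add: deg_lt_iff)

text \<open>Evaluation at \<open>t\<close> isolates the coefficient of \<open>lin u ^ n\<close>,
  which does not vanish there. Iterating the splitting gives the basis
  \<open>lin t ^ w * lin u ^ (n - w)\<close>, adapted to both points at once.\<close>

lemma deg_lt_split:
  fixes p :: "'a::field poly"
  assumes "deg_lt p (Suc n)" and "t \<noteq> u"
  obtains a q where "deg_lt q n" "p = smult a (lin u ^ n) + lin t * q"
proof -
  define a where "a = poly p t / (t - u) ^ n"
  have "poly (p - smult a (lin u ^ n)) t = 0"
    using assms(2) by (simp add: a_def)
  then obtain q where q: "p - smult a (lin u ^ n) = lin t * q"
    by (metis lin_dvd_iff dvd_def)
  have "deg_lt (p - smult a (lin u ^ n)) (Suc n)"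
    by (intro deg_lt_diff deg_lt_smult assms deg_lt_lin_power)
  then have "deg_lt q n" unfolding q by (simp add: deg_lt_lin_mult)
  with q show ?thesis by (intro that[of q a]) (auto simp: algebra_simps)
qed

lemma deg_lt_split_const:
  fixes p :: "'a::field poly"
  assumes "deg_lt p (Suc n)"
  obtains a q where "deg_lt q n" "p = [:a:] + lin t * q"
proof -
  have "poly (p - [:poly p t:]) t = 0" by simp
  then obtain q where q: "p - [:poly p t:] = lin t * q"
    by (metis lin_dvd_iff dvd_def)
  have "deg_lt (p - [:poly p t:]) (Suc n)"
    by (intro deg_lt_diff assms deg_lt_const) simp
  then have "deg_lt q n" unfolding q by (simp add: deg_lt_lin_mult)
  with q show ?thesis by (intro that[of q "poly p t"]) (auto simp: algebra_simps)
qed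

text \<open>The dehomogenization at \<open>z = 1\<close> of the derivation \<open>t \<partial>/\<partial>y + \<partial>/\<partial>z\<close> on binary forms of
  degree \<open>n\<close>; it annihilates exactly the multiples of \<open>(y - t z)\<^sup>n\<close>.\<close>

definition polar :: "nat \<Rightarrow> 'a::field \<Rightarrow> 'a poly \<Rightarrow> 'a poly" where
  "polar n t p = of_nat n * p - lin t * pderiv p"

lemma polar_0 [simp]: "polar n t 0 = 0" by (simp add: polar_def)

lemma polar_add: "polar n t (p + q) = polar n t p + polar n t q"
  by (simp add: polar_def pderiv_add algebra_simps)

lemma polar_diff: "polar n t (p - q) = polar n t p - polar n t q"
  by (simp add: polar_def pderiv_diff algebra_simps)

lemma polar_sum: "polar n t (sum f A) = (\<Sum>i\<in>A. polar n t (f i))"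
  by (induction A rule: infinite_finite_induct) (simp_all add: polar_add)

lemma pderiv_lin_power: "pderiv (lin t ^ Suc n) = of_nat (Suc n) * lin t ^ n"
  unfolding pderiv_power_Suc pderiv_lin by (simp add: of_nat_poly)

text \<open>The derivation annihilates \<open>y - t z\<close>, hence commutes with multiplication by
  it; only the degree index moves.\<close>

lemma polar_lin_mult: "polar (Suc n) t (lin t * p) = lin t * polar n t p"
  by (simp add: polar_def pderiv_mult algebra_simps)

lemma polar_lin_power_mult: "polar (b + n) t (lin t ^ b * p) = lin t ^ b * polar n t p"
  by (induction b) (simp_all add: mult.assoc polar_lin_mult)

text \<open>A derivation lowers the degree of a form by one. In dehomogenized terms the two
  contributions to the coefficient of \<open>y^n\<close> are \<open>n\<close> and \<open>- n\<close>
  and cancel.\<close>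

lemma deg_lt_polar: "deg_lt p (Suc n) \<Longrightarrow> deg_lt (polar n t p) n"
proof (induction n arbitrary: p)
  case 0
  then obtain c where "p = [:c:]"
    by (elim deg_lt_split_const[of _ _ 0]) auto
  then show ?case by (simp add: polar_def pderiv_pCons)
next
  case (Suc n)
  obtain a q where q: "deg_lt q (Suc n)" "p = [:a:] + lin t * q"
    using Suc.prems by (rule deg_lt_split_const)
  have "polar (Suc n) t [:a:] = smult (of_nat (Suc n)) [:a:]"
    by (simp add: polar_def pderiv_pCons of_nat_poly)
  then have "polar (Suc n) t p = smult (of_nat (Suc n)) [:a:] + lin t * polar n t q"
    unfolding q polar_add polar_lin_mult by simp
  also have "deg_lt \<dots> (Suc n)"
    using Suc.IH[OF q(1)]
    by (intro deg_lt_add deg_lt_smult deg_lt_const) (auto simp: deg_lt_lin_mult)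
  finally show ?case .
qed

text \<open>In the powers of \<open>lin t\<close> the map is diagonal: \<open>lin t ^ w\<close> is
  multiplied by \<open>n - w\<close>. In characteristic zero only \<open>w = n\<close> is lost,
  which gives surjectivity here and the one-dimensional kernel below.\<close>

lemma polar_surj:
  fixes r :: "'a::field_char_0 poly"
  assumes "deg_lt r n"
  obtains p where "deg_lt p (Suc n)" "polar n t p = r"
  using assms
proof (induction n arbitrary: r thesis)
  case 0
  then show ?case by (metis deg_lt_0 deg_lt_zero polar_0)
next
  case (Suc n)
  obtain a q where q: "deg_lt q n" "r = [:a:] + lin t * q"
    using Suc.prems(2) by (rule deg_lt_split_const)
  obtain p where p: "deg_lt p (Suc n)" "polar n t p = q" using Suc.IH q(1) by blast
  have "polar (Suc n) t [:a / of_nat (Suc n):] = [:a:]"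
    using of_nat_neq_0[of n, where 'a='a]
    by (simp add: polar_def pderiv_pCons of_nat_poly del: of_nat_Suc)
  then have "polar (Suc n) t ([:a / of_nat (Suc n):] + lin t * p) = r"
    unfolding polar_add polar_lin_mult p q by simp
  then show ?case
    by (rule Suc.prems(1)[rotated])
       (auto intro!: deg_lt_add deg_lt_const simp: deg_lt_lin_mult p)
qed

lemma polar_kernel:
  fixes p :: "'a::field_char_0 poly"
  assumes "deg_lt p (Suc n)" "polar n t p = 0"
  obtains c where "p = smult c (lin t ^ n)"
  using assms
proof (induction n arbitrary: p thesis)
  case 0
  then show ?case
    by (metis deg_lt_split_const[of p 0 t] deg_lt_0 add.right_neutral mult_zero_right power_0 smult_one)
next
  case (Suc n)
  obtain a q where q: "deg_lt q (Suc n)" "p = [:a:] + lin t * q"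
    using Suc.prems(2) by (rule deg_lt_split_const)
  have "polar (Suc n) t [:a:] = smult (of_nat (Suc n)) [:a:]"
    by (simp add: polar_def pderiv_pCons of_nat_poly)
  then have eq: "smult (of_nat (Suc n)) [:a:] + lin t * polar n t q = 0"
    using Suc.prems(3) unfolding q polar_add polar_lin_mult by simp
  have "of_nat (Suc n) * a = 0"
    using arg_cong[OF eq, of "\<lambda>p. poly p t"] by (simp del: of_nat_Suc)
  then have a: "a = 0" by (simp del: of_nat_Suc)
  with eq have "lin t * polar n t q = 0" by simp
  then have "polar n t q = 0" by simp
  then obtain c where "q = smult c (lin t ^ n)" using Suc.IH q(1) by blast
  then have "p = smult c (lin t ^ Suc n)" using a q by simp
  then show ?case by (rule Suc.prems)
qed

text \<open>What \<open>polar\<close> at \<open>u\<close> does to the cofactor of \<open>(y - t)\<^sup>b\<close>. It is triangular with nonzero diagonal in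
  the basis \<open>(y - t)\<^sup>w (y - u)\<^sup>n\<^sup>-\<^sup>w\<close>, hence bijective in characteristic zero.\<close>

definition polar_twist :: "nat \<Rightarrow> nat \<Rightarrow> 'a::field \<Rightarrow> 'a \<Rightarrow> 'a poly \<Rightarrow> 'a poly" where
  "polar_twist b n t u p = smult (of_nat b * (u - t)) p + lin t * polar n u p"

text \<open>Leibniz rule: the derivation at \<open>u\<close> sends \<open>y - t z\<close> to the
  constant \<open>u - t\<close>, so a power of it loses exactly one factor.\<close>

lemma polar_lin_power_mult_other:
  "polar (Suc b + n) u (lin t ^ Suc b * p) = lin t ^ b * polar_twist (Suc b) n t u p"
proof -
  define l where "l = lin t"
  define B :: "'a poly" where "B = of_nat b"
  define N :: "'a poly" where "N = of_nat n"
  define C where "C = [:u - t:]"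
  have s: "smult (of_nat (Suc b) * (u - t)) p = (B + 1) * C * p"
    by (simp add: C_def B_def of_nat_poly algebra_simps)
  have u: "lin u = l - C" by (simp add: C_def l_def lin_def)
  have "pderiv (l ^ Suc b * p) = l ^ Suc b * pderiv p + p * ((B + 1) * l ^ b)"
    unfolding pderiv_mult l_def pderiv_lin_power B_def by (simp add: add.commute)
  then show ?thesis
    unfolding polar_def polar_twist_def l_def[symmetric] s u
    by (simp add: B_def[symmetric] N_def[symmetric] algebra_simps)
qed

lemma deg_lt_polar_twist: "deg_lt p (Suc n) \<Longrightarrow> deg_lt (polar_twist b n t u p) (Suc n)"
  unfolding polar_twist_def
  by (intro deg_lt_add deg_lt_smult) (auto simp: deg_lt_lin_mult deg_lt_polar)

text \<open>The power of \<open>lin u\<close> is annihilated by \<open>polar\<close>, and pulling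
  out a factor \<open>lin t\<close> adds one more \<open>u - t\<close>, whence \<open>Suc b\<close>.
  The diagonal entry at \<open>lin t ^ w * lin u ^ (n - w)\<close> is thus
  \<open>(b + w) * (u - t)\<close>, which explains why the inductions below must generalize over
  \<open>b\<close>.\<close>

lemma polar_twist_split:
  "polar_twist b (Suc n) t u (smult a (lin u ^ Suc n) + lin t * q)
     = smult (of_nat b * (u - t) * a) (lin u ^ Suc n) + lin t * polar_twist (Suc b) n t u q"
proof -
  have 1: "polar (Suc n) u (smult a (lin u ^ Suc n)) = 0"
  proof -
    have "polar (Suc n) u (lin u ^ Suc n * [:a:]) = lin u ^ Suc n * polar 0 u [:a:]"
      using polar_lin_power_mult[of "Suc n" 0 u "[:a:]"] by simp
    then show ?thesis by (simp add: polar_def pderiv_pCons)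
  qed
  have 2: "polar (Suc n) u (lin t * q) = polar_twist 1 n t u q"
    using polar_lin_power_mult_other[of 0 n u t q] by simp
  have "polar_twist b (Suc n) t u (smult a (lin u ^ Suc n) + lin t * q)
      = smult (of_nat b * (u - t)) (smult a (lin u ^ Suc n) + lin t * q) + lin t * polar_twist 1 n t u q"
    unfolding polar_twist_def[of b "Suc n"] polar_add 1 2 by simp
  then show ?thesis
    by (simp add: polar_twist_def algebra_simps smult_add_left smult_add_right smult_diff_left)
qed

lemma polar_twist_base: "deg_lt p (Suc 0) \<Longrightarrow> polar_twist b 0 t u p = smult (of_nat b * (u - t)) p"
  using deg_lt_polar[of p 0 u] by (simp add: polar_twist_def)

lemma polar_twist_surj:
  fixes r :: "'a::field_char_0 poly"
  assumes "deg_lt r (Suc n)" "b > 0" "t \<noteq> u"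
  obtains p where "deg_lt p (Suc n)" "polar_twist b n t u p = r"
  using assms
proof (induction n arbitrary: r b thesis)
  case 0
  define p where "p = smult (1 / (of_nat b * (u - t))) r"
  have "deg_lt p (Suc 0)" unfolding p_def by (intro deg_lt_smult 0)
  moreover from this have "polar_twist b 0 t u p = r"
    using 0 by (simp add: polar_twist_base p_def)
  ultimately show ?case by (rule 0)
next
  case (Suc n)
  obtain a q where q: "deg_lt q (Suc n)" "r = smult a (lin u ^ Suc n) + lin t * q"
    using Suc.prems by (blast intro: deg_lt_split)
  obtain p where p: "deg_lt p (Suc n)" "polar_twist (Suc b) n t u p = q"
    using Suc.IH[OF _ q(1) zero_less_Suc Suc.prems(4)] by blast
  have "polar_twist b (Suc n) t u (smult (a / (of_nat b * (u - t))) (lin u ^ Suc n) + lin t * p) = r"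
    unfolding polar_twist_split p q using Suc.prems by simp
  then show ?case
    by (rule Suc.prems(1)[rotated], intro deg_lt_add deg_lt_smult deg_lt_lin_power)
       (simp add: deg_lt_lin_mult p)
qed

lemma polar_twist_inj:
  fixes p :: "'a::field_char_0 poly"
  assumes "deg_lt p (Suc n)" "b > 0" "t \<noteq> u" "polar_twist b n t u p = 0"
  shows "p = 0"
  using assms
proof (induction n arbitrary: p b)
  case 0
  then show ?case by (simp add: polar_twist_base)
next
  case (Suc n)
  obtain a q where q: "deg_lt q (Suc n)" "p = smult a (lin u ^ Suc n) + lin t * q"
    using Suc.prems by (blast intro: deg_lt_split)
  have eq: "smult (of_nat b * (u - t) * a) (lin u ^ Suc n) + lin t * polar_twist (Suc b) n t u q = 0"
    using Suc.prems(4) unfolding q polar_twist_split .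
  have "of_nat b * (u - t) * a * (t - u) ^ Suc n = 0"
    using arg_cong[OF eq, of "\<lambda>p. poly p t"] by simp
  then have a: "a = 0" using Suc.prems by auto
  with eq have "polar_twist (Suc b) n t u q = 0" by simp
  then have "q = 0" using Suc.IH q Suc.prems by blast
  then show ?case using a q by simp
qed

text \<open>Applying \<open>polar\<close> at one of the points lowers \<open>E\<close> and the multiplicity there by one and leaves
  the other multiplicities unchanged; this drives the inductions for this lemma and the next.\<close>

lemma hermite_span:
  fixes t :: "'k \<Rightarrow> 'a::field_char_0"
  assumes "finite K" "inj_on t K" "\<forall>k\<in>K. \<mu> k \<le> E" "E \<le> sum \<mu> K" "deg_lt h E"
  shows "\<exists>p. (\<forall>k\<in>K. deg_lt (p k) (\<mu> k)) \<and> h = (\<Sum>k\<in>K. lin (t k) ^ (E - \<mu> k) * p k)"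
  using assms(3-)
proof (induction E arbitrary: h \<mu>)
  case 0
  then show ?case by (intro exI[of _ "\<lambda>_. 0"]) simp
next
  case (Suc E)
  show ?case
  proof (cases "\<exists>k\<in>K. \<mu> k = Suc E")
    case True
    \<comment> \<open>The exponent at this \<open>k\<close> is 0, so its space alone is everything.
      In the other case all exponents are at least 1, as \<open>polar_lin_power_mult_other\<close>
      demands.\<close>
    then obtain k where k: "k \<in> K" "\<mu> k = Suc E" by blast
    have "(\<Sum>i\<in>K. lin (t i) ^ (Suc E - \<mu> i) * (if i = k then h else 0)) = h"
      using k assms(1) by (subst sum.remove[of _ k]) auto
    then show ?thesis using k Suc.prems(3)
      by (intro exI[of _ "\<lambda>i. if i = k then h else 0"]) auto
  next
    case False
    then have le: "\<mu> k \<le> E" if "k \<in> K" for k using Suc.prems(1) that by (metis le_SucE)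
    obtain k1 where k1: "k1 \<in> K" "\<mu> k1 > 0"
      using Suc.prems(2) by (metis sum.neutral not_gr_zero Suc_n_not_le_n le0 le_trans not_less_eq_eq)
    \<comment> \<open>At \<open>k1\<close> the exponent \<open>E - \<nu> k1\<close> equals
      \<open>Suc E - \<mu> k1\<close> and the dimension drops; at every other point the exponent
      drops and the dimension stays. Both the total dimension and \<open>Suc E\<close> go down by
      one.\<close>
    define \<nu> where "\<nu> = \<mu>(k1 := \<mu> k1 - 1)"
    define b where "b k = E - \<mu> k" for k
    have "sum \<nu> K = (\<mu> k1 - 1) + sum \<mu> (K - {k1})"
      using k1 assms(1) by (subst sum.remove[of _ k1]) (auto simp: \<nu>_def intro!: sum.cong)
    moreover have "sum \<mu> K = \<mu> k1 + sum \<mu> (K - {k1})"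
      using k1 assms(1) by (subst sum.remove[of _ k1]) auto
    ultimately have "E \<le> sum \<nu> K" using k1 Suc.prems(2) by linarith
    moreover have "\<forall>k\<in>K. \<nu> k \<le> E" using le by (auto simp: \<nu>_def le_diff_conv intro: le_SucI)
    ultimately obtain p where p: "\<forall>k\<in>K. deg_lt (p k) (\<nu> k)"
      "polar E (t k1) h = (\<Sum>k\<in>K. lin (t k) ^ (E - \<nu> k) * p k)"
      using Suc.IH deg_lt_polar[OF Suc.prems(3)] by blast
    have "\<exists>q. deg_lt q (\<mu> k) \<and>
        polar E (t k1) (lin (t k) ^ (Suc E - \<mu> k) * q) = lin (t k) ^ (E - \<nu> k) * p k"
      if k: "k \<in> K" for k
    proof (cases "\<mu> k = 0")
      case True
      moreover from this have "p k = 0" using bspec[OF p(1) k] k1 by (auto simp: \<nu>_def split: if_splits)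
      ultimately show ?thesis by (intro exI[of _ 0]) simp
    next
      case nz: False
      then obtain n where n: "\<mu> k = Suc n" by (cases "\<mu> k") auto
      show ?thesis
      proof (cases "k = k1")
        case True
        then have "deg_lt (p k) n" using p(1) k n by (auto simp: \<nu>_def)
        then obtain q where q: "deg_lt q (Suc n)" "polar n (t k) q = p k" by (rule polar_surj)
        have "E = (Suc E - \<mu> k) + n" "Suc E - \<mu> k = E - \<nu> k"
          using le[OF k] n True by (auto simp: \<nu>_def)
        then have "polar E (t k1) (lin (t k) ^ (Suc E - \<mu> k) * q) = lin (t k) ^ (E - \<nu> k) * p k"
          using polar_lin_power_mult[of "Suc E - \<mu> k" n "t k" q] q True by metis
        then show ?thesis using q n by auto
      next
        case neq: False
        then have "t k \<noteq> t k1" using k k1 assms(2) by (auto dest: inj_onD)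
        moreover have "deg_lt (p k) (Suc n)" using p(1) k n neq by (auto simp: \<nu>_def)
        ultimately obtain q where q: "deg_lt q (Suc n)"
            "polar_twist (Suc (b k)) n (t k) (t k1) q = p k"
          by (metis polar_twist_surj zero_less_Suc)
        have "E = Suc (b k) + n" "Suc E - \<mu> k = Suc (b k)" "E - \<nu> k = b k"
          using le[OF k] n neq by (auto simp: \<nu>_def b_def)
        then have "polar E (t k1) (lin (t k) ^ (Suc E - \<mu> k) * q) = lin (t k) ^ (E - \<nu> k) * p k"
          using polar_lin_power_mult_other[of "b k" n "t k1" "t k" q] q by metis
        then show ?thesis using q n by auto
      qed
    qed
    then obtain q where q: "\<And>k. k \<in> K \<Longrightarrow> deg_lt (q k) (\<mu> k)"
      "\<And>k. k \<in> K \<Longrightarrow> polar E (t k1) (lin (t k) ^ (Suc E - \<mu> k) * q k) = lin (t k) ^ (E - \<nu> k) * p k"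
      by metis
    \<comment> \<open>Lifting every summand through \<open>polar\<close> recovers \<open>h\<close>
      only up to the kernel of \<open>polar\<close>, the multiples of
      \<open>lin (t k1) ^ E\<close>.\<close>
    define r where "r = h - (\<Sum>k\<in>K. lin (t k) ^ (Suc E - \<mu> k) * q k)"
    have "deg_lt r (Suc E)" unfolding r_def
      using Suc.prems(1) q(1) by (intro deg_lt_diff deg_lt_sum Suc.prems deg_lt_lin_power_mult') auto
    moreover have "polar E (t k1) r = 0"
      by (simp add: r_def polar_diff polar_sum p(2) q(2))
    ultimately obtain c where c: "r = smult c (lin (t k1) ^ E)" by (rule polar_kernel)
    \<comment> \<open>The kernel element is a multiple of
      \<open>lin (t k1) ^ (Suc E - \<mu> k1)\<close>; since \<open>\<mu> k1\<close> is positive, the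
      cofactor at \<open>k1\<close> has room for it.\<close>
    define s where "s k = q k + (if k = k1 then smult c (lin (t k1) ^ (\<mu> k1 - 1)) else 0)" for k
    have eqE: "(Suc E - \<mu> k1) + (\<mu> k1 - 1) = E" using le[OF k1(1)] k1(2) by simp
    have eqP: "lin (t k1) ^ (Suc E - \<mu> k1) * smult c (lin (t k1) ^ (\<mu> k1 - 1)) = smult c (lin (t k1) ^ E)"
      using eqE by (metis mult_smult_right power_add)
    have "(\<Sum>k\<in>K. lin (t k) ^ (Suc E - \<mu> k) * s k) =
        (\<Sum>k\<in>K. lin (t k) ^ (Suc E - \<mu> k) * q k +
           (if k = k1 then lin (t k1) ^ (Suc E - \<mu> k1) * smult c (lin (t k1) ^ (\<mu> k1 - 1)) else 0))"
      by (intro sum.cong) (auto simp: s_def distrib_left)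
    also have "\<dots> = (\<Sum>k\<in>K. lin (t k) ^ (Suc E - \<mu> k) * q k) + r"
      unfolding eqP using k1 assms(1) by (simp add: sum.distrib c)
    also have "\<dots> = h" by (simp add: r_def)
    finally have "h = (\<Sum>k\<in>K. lin (t k) ^ (Suc E - \<mu> k) * s k)" ..
    moreover have "deg_lt (s k) (\<mu> k)" if "k \<in> K" for k
      using q(1)[OF that] k1(2) deg_lt_lin_power[of "t k1" "\<mu> k1 - 1"]
      by (auto simp: s_def intro!: deg_lt_add deg_lt_smult)
    ultimately show ?thesis by blast
  qed
qed

lemma hermite_independent:
  fixes t :: "'k \<Rightarrow> 'a::field_char_0"
  assumes "finite K" "inj_on t K" "sum \<mu> K \<le> E" "\<forall>k\<in>K. deg_lt (p k) (\<mu> k)"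
    and "(\<Sum>k\<in>K. lin (t k) ^ (E - \<mu> k) * p k) = 0" and "k \<in> K"
  shows "p k = 0"
  using assms(3-)
proof (induction E arbitrary: p \<mu> k)
  case 0
  then show ?case using assms(1) by auto
next
  case (Suc E)
  have le: "\<mu> k \<le> Suc E" if "k \<in> K" for k
    using Suc.prems(1) member_le_sum[of k K \<mu>] that assms(1) by (simp add: le_trans)
  have split: "sum \<mu> K = \<mu> k + sum \<mu> (K - {k})" if "k \<in> K" for k
    using that assms(1) by (simp add: sum.remove)
  show ?case
  proof (cases "\<exists>k\<in>K. \<mu> k = Suc E")
    case True
    then obtain k0 where k0: "k0 \<in> K" "\<mu> k0 = Suc E" by blast
    \<comment> \<open>A multiplicity \<open>Suc E\<close> at \<open>k0\<close> exhausts the bound on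
      the sum, so no other point has a nonzero cofactor.\<close>
    have z: "p k = 0" if "k \<in> K - {k0}" for k
    proof -
      have "sum \<mu> (K - {k0}) = 0" using split[OF k0(1)] Suc.prems(1) k0 by simp
      then have "\<mu> k = 0" using that assms(1) by simp
      then show ?thesis using Suc.prems(2) that by force
    qed
    have "(\<Sum>k\<in>K. lin (t k) ^ (Suc E - \<mu> k) * p k) = p k0"
      using k0 assms(1) z by (simp add: sum.remove)
    with z Suc.prems(3,4) show ?thesis by (cases "k = k0") auto
  next
    case False
    then have le: "\<mu> k \<le> E" if "k \<in> K" for k using le[OF that] that by (metis le_SucE)
    show ?thesis
    proof (cases "sum \<mu> K = 0")
      case True
      then show ?thesis using Suc.prems(2,4) assms(1) by auto
    next
      case False
      then obtain k1 where k1: "k1 \<in> K" "\<mu> k1 > 0"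
        by (metis sum.neutral not_gr_zero)
      define \<nu> where "\<nu> = \<mu>(k1 := \<mu> k1 - 1)"
      define b where "b k = E - \<mu> k" for k
      have "sum \<nu> K = (\<mu> k1 - 1) + sum \<mu> (K - {k1})"
        using k1 assms(1) by (subst sum.remove[of _ k1]) (auto simp: \<nu>_def intro!: sum.cong)
      then have sum\<nu>: "sum \<nu> K \<le> E" using k1 Suc.prems(1) split[OF k1(1)] by linarith
      \<comment> \<open>These are the cofactors that remain after \<open>polar\<close> at
        \<open>t k1\<close> is applied to the relation, in the shape required by the induction
        hypothesis for \<open>\<nu>\<close>.\<close>
      define q where "q k = (if k = k1 then polar (\<mu> k - 1) (t k) (p k)
         else polar_twist (Suc (b k)) (\<mu> k - 1) (t k) (t k1) (p k))" for k
      have pq: "polar E (t k1) (lin (t k) ^ (Suc E - \<mu> k) * p k) = lin (t k) ^ (E - \<nu> k) * q k"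
        and dq: "deg_lt (q k) (\<nu> k)" if k: "k \<in> K" for k
      proof -
        have d: "deg_lt (p k) (\<mu> k)" using Suc.prems(2) k by blast
        have "polar E (t k1) (lin (t k) ^ (Suc E - \<mu> k) * p k) = lin (t k) ^ (E - \<nu> k) * q k
           \<and> deg_lt (q k) (\<nu> k)"
        proof (cases "\<mu> k = 0")
          case True
          with d k1 show ?thesis by (auto simp: \<nu>_def q_def polar_twist_def)
        next
          case nz: False
          then obtain n where n: "\<mu> k = Suc n" by (cases "\<mu> k") auto
          show ?thesis
          proof (cases "k = k1")
            case True
            have "E = (Suc E - \<mu> k) + n" "Suc E - \<mu> k = E - \<nu> k"
              using le[OF k] n True by (auto simp: \<nu>_def)
            then have "polar E (t k1) (lin (t k) ^ (Suc E - \<mu> k) * p k) = lin (t k) ^ (E - \<nu> k) * polar n (t k) (p k)"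
              using polar_lin_power_mult[of "Suc E - \<mu> k" n "t k" "p k"] True by metis
            then show ?thesis using deg_lt_polar[of "p k" n "t k"] d n True by (auto simp: q_def \<nu>_def)
          next
            case neq: False
            have "E = Suc (b k) + n" "Suc E - \<mu> k = Suc (b k)" "E - \<nu> k = b k"
              using le[OF k] n neq by (auto simp: \<nu>_def b_def)
            then have "polar E (t k1) (lin (t k) ^ (Suc E - \<mu> k) * p k)
                = lin (t k) ^ (E - \<nu> k) * polar_twist (Suc (b k)) n (t k) (t k1) (p k)"
              using polar_lin_power_mult_other[of "b k" n "t k1" "t k" "p k"] by metis
            then show ?thesis using deg_lt_polar_twist[of "p k" n] d n neq by (auto simp: q_def \<nu>_def)
          qed
        qed
        then show "polar E (t k1) (lin (t k) ^ (Suc E - \<mu> k) * p k) = lin (t k) ^ (E - \<nu> k) * q k"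
          "deg_lt (q k) (\<nu> k)" by auto
      qed
      have "(\<Sum>k\<in>K. lin (t k) ^ (E - \<nu> k) * q k)
          = polar E (t k1) (\<Sum>k\<in>K. lin (t k) ^ (Suc E - \<mu> k) * p k)"
        by (simp add: polar_sum pq)
      then have "(\<Sum>k\<in>K. lin (t k) ^ (E - \<nu> k) * q k) = 0"
        unfolding Suc.prems(3) by simp
      then have q0: "q k = 0" if "k \<in> K" for k
        using Suc.IH[OF sum\<nu>] dq that by blast
      have z: "p k = 0" if k: "k \<in> K - {k1}" for k
      proof (cases "\<mu> k")
        case 0
        then show ?thesis using Suc.prems(2) k by force
      next
        case (Suc n)
        have "t k \<noteq> t k1" using k k1 assms(2) by (auto dest: inj_onD)
        moreover have "polar_twist (Suc (b k)) n (t k) (t k1) (p k) = 0"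
          using q0[of k] k Suc by (simp add: q_def)
        moreover have "deg_lt (p k) (Suc n)" using Suc.prems(2) k Suc by force
        ultimately show ?thesis by (metis polar_twist_inj zero_less_Suc)
      qed
      \<comment> \<open>At \<open>k1\<close> the vanishing of \<open>q k1\<close> is not enough,
        because \<open>polar\<close> has a kernel. With all other cofactors gone, the original
        relation settles \<open>p k1\<close>.\<close>
      have "(\<Sum>k\<in>K. lin (t k) ^ (Suc E - \<mu> k) * p k) = lin (t k1) ^ (Suc E - \<mu> k1) * p k1"
        using k1 assms(1) z by (simp add: sum.remove)
      then have "p k1 = 0" using Suc.prems(3) by simp
      with z Suc.prems(4) show ?thesis by (cases "k = k1") auto
    qed
  qed
qed

section \<open>Pairs of binary forms\<close>

lemma sum_plus_indicator:
  assumes "finite K" "A \<subseteq> K"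
  shows "(\<Sum>k\<in>K. d k + (if k \<in> A then 1 else 0)) = sum d K + (card A :: nat)"
    and "(\<Sum>k\<in>K. d k + (if k \<in> A then 0 else 1)) = sum d K + (card K - card A :: nat)"
proof -
  have "(\<Sum>k\<in>K. if k \<in> A then 1 else 0) = card (K \<inter> A)"
    using assms by (simp add: sum.If_cases)
  with assms show "(\<Sum>k\<in>K. d k + (if k \<in> A then 1 else 0)) = sum d K + card A"
    by (simp add: sum.distrib Int_absorb1)
  have "(\<Sum>k\<in>K. if k \<in> A then 0 else 1) = card (K - A)"
    using assms by (simp add: sum.If_cases Diff_eq)
  with assms show "(\<Sum>k\<in>K. d k + (if k \<in> A then 0 else 1)) = sum d K + (card K - card A)"
    by (simp add: sum.distrib card_Diff_subset finite_subset)
qed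

text \<open>Modulo \<open>x\<^sup>2\<close>, \<open>(l + c x)\<^sup>a (p + x q) = l\<^sup>a p + x (l\<^sup>a q + a c l\<^sup>a\<^sup>-\<^sup>1 p)\<close>. The points lie on the line
  \<open>x = 0\<close> for the indices in \<open>A\<close> and off it for the others; the size of \<open>A\<close> is chosen so that the
  constant layer and the \<open>x\<close>-layer are simultaneously of maximal rank.\<close>

locale double_line_pairs =
  fixes t :: "'k \<Rightarrow> 'a::field_char_0" and a :: "'k \<Rightarrow> nat" and j :: nat and K A :: "'k set"
  assumes finite_K: "finite K" and inj_t: "inj_on t K"
    and a_pos: "k \<in> K \<Longrightarrow> 1 \<le> a k" and a_le: "k \<in> K \<Longrightarrow> a k \<le> j"
    and A_subset: "A \<subseteq> K" and card_A: "card A = min (card K) (j + 1 - (\<Sum>k\<in>K. j - a k))"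
begin

definition c :: "'k \<Rightarrow> 'a" where "c k = (if k \<in> A then 0 else 1)"

lemma card_A_le: "card A \<le> card K"
  by (simp add: card_mono finite_K A_subset)

lemma sum_first: "(\<Sum>k\<in>K. j - a k + (if k \<in> A then 1 else 0)) = (\<Sum>k\<in>K. j - a k) + card A"
  and sum_second: "(\<Sum>k\<in>K. j - a k + (if k \<in> A then 0 else 1)) = (\<Sum>k\<in>K. j - a k) + (card K - card A)"
  by (rule sum_plus_indicator[OF finite_K A_subset])+

text \<open>Off \<open>A\<close> the \<open>x\<close>-layer sees \<open>p\<close> and
  \<open>q\<close> only through \<open>Q = lin t * q + a * p\<close>, which is arbitrary of the
  larger degree and comes with exponent \<open>a - 1\<close>. Once \<open>Q\<close> is fixed, the
  constant layer is left with the freedom of \<open>q\<close> alone, with exponent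
  \<open>a + 1\<close>. The system is therefore triangular: the \<open>x\<close>-layer is solved
  first, then the constant layer.\<close>

lemma span:
  assumes "2 * j + 1 \<le> (\<Sum>k\<in>K. 2 * (j - a k) + 1)" "deg_lt f (j + 1)" "deg_lt g j"
  shows "\<exists>p q. (\<forall>k\<in>K. deg_lt (p k) (j + 1 - a k) \<and> deg_lt (q k) (j - a k)) \<and>
    f = (\<Sum>k\<in>K. lin (t k) ^ a k * p k) \<and>
    g = (\<Sum>k\<in>K. lin (t k) ^ a k * q k + smult (of_nat (a k) * c k) (lin (t k) ^ (a k - 1) * p k))"
proof -
  define D where "D = (\<Sum>k\<in>K. j - a k)"
  have S: "2 * j + 1 \<le> 2 * D + card K"
    using assms(1) unfolding D_def sum_distrib_left sum.distrib by simp
  have ex1: "j + 1 - (j - a k + (if k \<in> A then 1 else 0)) = (if k \<in> A then a k else Suc (a k))"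
    and ex2: "j - (j - a k + (if k \<in> A then 0 else 1)) = (if k \<in> A then a k else a k - 1)"
    if "k \<in> K" for k
    using a_le[OF that] a_pos[OF that] by auto
  have "\<exists>Q. (\<forall>k\<in>K. deg_lt (Q k) (j - a k + (if k \<in> A then 0 else 1))) \<and>
    g = (\<Sum>k\<in>K. lin (t k) ^ (j - (j - a k + (if k \<in> A then 0 else 1))) * Q k)"
  proof (rule hermite_span[OF finite_K inj_t _ _ assms(3)])
    \<comment> \<open>If the minimum in \<open>card_A\<close> is \<open>card K\<close>, the
      hypothesis forces \<open>D \<ge> j\<close>; otherwise \<open>card A\<close> is
      \<open>j + 1 - D\<close>, truncated at 0. Either way both layers have enough
      dimensions.\<close>
    show "j \<le> (\<Sum>k\<in>K. j - a k + (if k \<in> A then 0 else 1))"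
      unfolding sum_second using S card_A card_A_le unfolding D_def by linarith
  next
    show "\<forall>k\<in>K. j - a k + (if k \<in> A then 0 else 1) \<le> j" using a_le a_pos by force
  qed
  then obtain Q where Q: "\<And>k. k \<in> K \<Longrightarrow> deg_lt (Q k) (j - a k + (if k \<in> A then 0 else 1))"
    "g = (\<Sum>k\<in>K. lin (t k) ^ (if k \<in> A then a k else a k - 1) * Q k)"
    by (auto simp: ex2 cong: sum.cong)
  \<comment> \<open>What the choice \<open>p = Q / a\<close> off \<open>A\<close> already
    contributes to the constant layer is subtracted before that layer is solved.\<close>
  define f' where "f' = f - (\<Sum>k\<in>K. if k \<in> A then 0 else lin (t k) ^ a k * smult (1 / of_nat (a k)) (Q k))"
  have "deg_lt f' (j + 1)" unfolding f'_def
  proof (intro deg_lt_diff deg_lt_sum assms(2))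
    fix k assume k: "k \<in> K"
    show "deg_lt (if k \<in> A then 0 else lin (t k) ^ a k * smult (1 / of_nat (a k)) (Q k)) (j + 1)"
      using deg_lt_lin_power_mult'[OF deg_lt_smult[OF Q(1)[OF k]], of "a k" "j + 1" "t k" "1 / of_nat (a k)"]
        a_le[OF k] by auto
  qed
  have "\<exists>P. (\<forall>k\<in>K. deg_lt (P k) (j - a k + (if k \<in> A then 1 else 0))) \<and>
    f' = (\<Sum>k\<in>K. lin (t k) ^ (j + 1 - (j - a k + (if k \<in> A then 1 else 0))) * P k)"
  proof (rule hermite_span[OF finite_K inj_t _ _ \<open>deg_lt f' (j + 1)\<close>])
    show "j + 1 \<le> (\<Sum>k\<in>K. j - a k + (if k \<in> A then 1 else 0))"
      unfolding sum_first using S card_A card_A_le unfolding D_def by linarith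
  next
    show "\<forall>k\<in>K. j - a k + (if k \<in> A then 1 else 0) \<le> j + 1" using a_le a_pos by force
  qed
  then obtain P where P: "\<And>k. k \<in> K \<Longrightarrow> deg_lt (P k) (j - a k + (if k \<in> A then 1 else 0))"
    and "f' = (\<Sum>k\<in>K. lin (t k) ^ (j + 1 - (j - a k + (if k \<in> A then 1 else 0))) * P k)"
    by blast
  then have f': "f' = (\<Sum>k\<in>K. lin (t k) ^ (if k \<in> A then a k else Suc (a k)) * P k)"
    by (simp only: ex1 cong: sum.cong)
  \<comment> \<open>Off \<open>A\<close> this inverts the substitution:
    \<open>lin t * q + a * p\<close> is again \<open>Q\<close>, whatever \<open>P\<close>
    is.\<close>
  define p where "p k = (if k \<in> A then P k else lin (t k) * P k + smult (1 / of_nat (a k)) (Q k))" for k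
  define q where "q k = (if k \<in> A then Q k else - smult (of_nat (a k)) (P k))" for k
  have "deg_lt (p k) (j + 1 - a k) \<and> deg_lt (q k) (j - a k)" if k: "k \<in> K" for k
  proof -
    have "j + 1 - a k = Suc (j - a k)" using a_le[OF k] by simp
    then show ?thesis using P[OF k] Q(1)[OF k]
      by (auto simp: p_def q_def deg_lt_lin_mult simp flip: smult_minus_left intro!: deg_lt_add deg_lt_smult)
  qed
  moreover have "f = (\<Sum>k\<in>K. lin (t k) ^ a k * p k)"
  proof -
    have "f = f' + (\<Sum>k\<in>K. if k \<in> A then 0 else lin (t k) ^ a k * smult (1 / of_nat (a k)) (Q k))"
      by (simp add: f'_def)
    also have "\<dots> = (\<Sum>k\<in>K. lin (t k) ^ a k * p k)"
      unfolding f' sum.distrib[symmetric]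
      by (intro sum.cong) (auto simp: p_def algebra_simps)
    finally show ?thesis .
  qed
  moreover have "g = (\<Sum>k\<in>K. lin (t k) ^ a k * q k + smult (of_nat (a k) * c k) (lin (t k) ^ (a k - 1) * p k))"
    unfolding Q(2)
  proof (intro sum.cong refl)
    fix k assume k: "k \<in> K"
    obtain b where b: "a k = Suc b" using a_pos[OF k] by (cases "a k") auto
    show "lin (t k) ^ (if k \<in> A then a k else a k - 1) * Q k =
      lin (t k) ^ a k * q k + smult (of_nat (a k) * c k) (lin (t k) ^ (a k - 1) * p k)"
      using of_nat_neq_0[of b, where 'a='a]
      by (auto simp: b p_def q_def c_def algebra_simps smult_add_right simp del: of_nat_Suc)
  qed
  ultimately show ?thesis by blast
qed

text \<open>The same triangular system read backwards: the \<open>x\<close>-layer kills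
  \<open>lin t * q + a * p\<close> off \<open>A\<close>, so \<open>p\<close> is a multiple of
  \<open>lin t\<close> there and the constant layer becomes an interpolation problem for
  \<open>q\<close>.\<close>

lemma independent:
  assumes "(\<Sum>k\<in>K. 2 * (j - a k) + 1) \<le> 2 * j + 1"
    and deg: "\<And>k. k \<in> K \<Longrightarrow> deg_lt (p k) (j + 1 - a k)" "\<And>k. k \<in> K \<Longrightarrow> deg_lt (q k) (j - a k)"
    and f: "(\<Sum>k\<in>K. lin (t k) ^ a k * p k) = 0"
    and g: "(\<Sum>k\<in>K. lin (t k) ^ a k * q k + smult (of_nat (a k) * c k) (lin (t k) ^ (a k - 1) * p k)) = 0"
    and k: "k \<in> K"
  shows "p k = 0 \<and> q k = 0"
proof -
  define D where "D = (\<Sum>k\<in>K. j - a k)"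
  have S: "2 * D + card K \<le> 2 * j + 1"
    using assms(1) unfolding D_def sum_distrib_left sum.distrib by simp
  have ex1: "j + 1 - (j - a k + (if k \<in> A then 1 else 0)) = (if k \<in> A then a k else Suc (a k))"
    and ex2: "j - (j - a k + (if k \<in> A then 0 else 1)) = (if k \<in> A then a k else a k - 1)"
    if "k \<in> K" for k
    using a_le[OF that] a_pos[OF that] by auto
  define Q where "Q k = (if k \<in> A then q k else lin (t k) * q k + smult (of_nat (a k)) (p k))" for k
  have dQ: "deg_lt (Q k) (j - a k + (if k \<in> A then 0 else 1))" if "k \<in> K" for k
  proof -
    have "j + 1 - a k = Suc (j - a k)" using a_le[OF that] by simp
    then show ?thesis using deg[OF that]
      by (auto simp: Q_def deg_lt_lin_mult intro!: deg_lt_add deg_lt_smult)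
  qed
  have "(\<Sum>k\<in>K. lin (t k) ^ (j - (j - a k + (if k \<in> A then 0 else 1))) * Q k) = 0"
    unfolding g[symmetric]
  proof (intro sum.cong refl)
    fix k assume k: "k \<in> K"
    obtain b where b: "a k = Suc b" using a_pos[OF k] by (cases "a k") auto
    show "lin (t k) ^ (j - (j - a k + (if k \<in> A then 0 else 1))) * Q k =
      lin (t k) ^ a k * q k + smult (of_nat (a k) * c k) (lin (t k) ^ (a k - 1) * p k)"
      unfolding ex2[OF k] by (auto simp: b Q_def c_def algebra_simps simp del: of_nat_Suc)
  qed
  moreover have "(\<Sum>k\<in>K. j - a k + (if k \<in> A then 0 else 1)) \<le> j"
    unfolding sum_second using S card_A card_A_le unfolding D_def by linarith
  ultimately have Q0: "Q k = 0" if "k \<in> K" for k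
    using hermite_independent[OF finite_K inj_t] dQ that by blast
  \<comment> \<open>Off \<open>A\<close> the relation \<open>Q = 0\<close> reads
    \<open>p = lin t * P\<close>, which raises the exponent in the constant layer to
    \<open>a + 1\<close>. Division by \<open>a\<close> uses characteristic zero.\<close>
  define P where "P k = (if k \<in> A then p k else - smult (1 / of_nat (a k)) (q k))" for k
  have pP: "lin (t k) ^ a k * p k = lin (t k) ^ (if k \<in> A then a k else Suc (a k)) * P k"
    if k: "k \<in> K" for k
  proof (cases "k \<in> A")
    case False
    obtain b where b: "a k = Suc b" using a_pos[OF k] by (cases "a k") auto
    have "smult (1 / of_nat (a k)) (lin (t k) * q k + smult (of_nat (a k)) (p k)) = 0"
      using Q0[OF k] False by (simp add: Q_def)
    then have "p k = lin (t k) * P k"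
      using False of_nat_neq_0[of b, where 'a='a]
      by (simp add: P_def b smult_add_right eq_neg_iff_add_eq_0 add.commute del: of_nat_Suc)
    then show ?thesis using False by simp
  qed (simp add: P_def)
  have "(\<Sum>k\<in>K. lin (t k) ^ (j + 1 - (j - a k + (if k \<in> A then 1 else 0))) * P k) = 0"
    unfolding f[symmetric] by (intro sum.cong refl) (simp only: ex1 pP)
  moreover have "(\<Sum>k\<in>K. j - a k + (if k \<in> A then 1 else 0)) \<le> j + 1"
    unfolding sum_first using S card_A card_A_le unfolding D_def by linarith
  moreover have "deg_lt (P k) (j - a k + (if k \<in> A then 1 else 0))" if "k \<in> K" for k
  proof -
    have "j + 1 - a k = Suc (j - a k)" using a_le[OF that] by simp
    then show ?thesis using deg[OF that]
      by (auto simp: P_def simp flip: smult_minus_left intro!: deg_lt_smult)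
  qed
  ultimately have P0: "P k = 0"
    using hermite_independent[OF finite_K inj_t] k by blast
  have p0: "p k = 0" using pP[OF k] P0 by simp
  moreover have "q k = 0" using Q0[OF k] p0 by (simp add: Q_def split: if_splits)
  ultimately show ?thesis by blast
qed

end

section \<open>Generic properties\<close>

definition mono_eval :: "(nat \<Rightarrow>\<^sub>0 nat) \<Rightarrow> (nat \<Rightarrow> 'a::comm_ring_1) \<Rightarrow> 'a" where
  "mono_eval m v = (\<Prod>i\<in>Poly_Mapping.keys m. v i ^ Poly_Mapping.lookup m i)"

lemma mono_eval_superset:
  assumes "finite S" "Poly_Mapping.keys m \<subseteq> S"
  shows "mono_eval m v = (\<Prod>i\<in>S. v i ^ Poly_Mapping.lookup m i)"
  unfolding mono_eval_def using assms
  by (intro prod.mono_neutral_left) (auto simp: in_keys_iff)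

lemma mono_eval_0 [simp]: "mono_eval 0 v = 1"
  by (simp add: mono_eval_def)

lemma mono_eval_add: "mono_eval (m + n) v = mono_eval m v * mono_eval n v"
proof -
  let ?S = "Poly_Mapping.keys m \<union> Poly_Mapping.keys n"
  have "mono_eval (m + n) v = (\<Prod>i\<in>?S. v i ^ Poly_Mapping.lookup (m + n) i)"
    using keys_add[of m n] by (intro mono_eval_superset) auto
  also have "\<dots> = mono_eval m v * mono_eval n v"
    by (simp add: mono_eval_superset[of ?S] lookup_add power_add prod.distrib)
  finally show ?thesis .
qed

lemma mp_eval_superset:
  assumes "finite S" "Poly_Mapping.keys p \<subseteq> S"
  shows "mp_eval p v = (\<Sum>m\<in>S. Poly_Mapping.lookup p m * mono_eval m v)"
  unfolding mp_eval_def mono_eval_def[symmetric] using assms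
  by (intro sum.mono_neutral_left) (auto simp: in_keys_iff)

lemma mp_eval_0 [simp]: "mp_eval 0 v = 0"
  by (simp add: mp_eval_def)

lemma mp_eval_add: "mp_eval (p + q) v = mp_eval p v + mp_eval q v"
proof -
  let ?S = "Poly_Mapping.keys p \<union> Poly_Mapping.keys q"
  have "mp_eval (p + q) v = (\<Sum>m\<in>?S. Poly_Mapping.lookup (p + q) m * mono_eval m v)"
    using keys_add[of p q] by (intro mp_eval_superset) auto
  also have "\<dots> = mp_eval p v + mp_eval q v"
    by (simp add: mp_eval_superset[of ?S] lookup_add distrib_right sum.distrib)
  finally show ?thesis .
qed

lemma mp_eval_sum: "mp_eval (sum f A) v = (\<Sum>i\<in>A. mp_eval (f i) v)"
  by (induction A rule: infinite_finite_induct) (simp_all add: mp_eval_add)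

lemma mp_eval_single: "mp_eval (Poly_Mapping.single m c) v = c * mono_eval m v"
  by (subst mp_eval_superset[of "{m}"]) auto

lemma mpoly_expansion:
  assumes "finite S" "Poly_Mapping.keys p \<subseteq> S"
  shows "p = (\<Sum>m\<in>S. Poly_Mapping.single m (Poly_Mapping.lookup p m))"
proof (rule poly_mapping_eqI)
  fix m
  have "(\<Sum>n\<in>S. Poly_Mapping.lookup p n when n = m) = (if m \<in> S then Poly_Mapping.lookup p m else 0)"
    using assms(1) by (simp add: when_def)
  also have "\<dots> = Poly_Mapping.lookup p m" using assms(2) by (auto simp: in_keys_iff)
  finally show "Poly_Mapping.lookup p m =
      Poly_Mapping.lookup (\<Sum>n\<in>S. Poly_Mapping.single n (Poly_Mapping.lookup p n)) m"
    by (simp add: lookup_sum lookup_single)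
qed

lemma mp_eval_mult: "mp_eval (p * q) v = mp_eval p v * mp_eval q v"
proof -
  have "p * q = (\<Sum>m\<in>Poly_Mapping.keys p. \<Sum>n\<in>Poly_Mapping.keys q.
      Poly_Mapping.single m (Poly_Mapping.lookup p m) * Poly_Mapping.single n (Poly_Mapping.lookup q n))"
    unfolding sum_product[symmetric] by (simp flip: mpoly_expansion)
  then have "mp_eval (p * q) v = (\<Sum>m\<in>Poly_Mapping.keys p. \<Sum>n\<in>Poly_Mapping.keys q.
      (Poly_Mapping.lookup p m * mono_eval m v) * (Poly_Mapping.lookup q n * mono_eval n v))"
    by (simp add: mult_single mp_eval_sum mp_eval_single mono_eval_add mult_ac)
  then show ?thesis
    by (simp only: mp_eval_superset[OF finite_keys subset_refl] sum_product)
qed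

lemma mp_in_vars_add: "mp_in_vars N p \<Longrightarrow> mp_in_vars N q \<Longrightarrow> mp_in_vars N (p + q)"
  using keys_add[of p q] by (auto simp: mp_in_vars_def)

lemma mp_in_vars_mult: "mp_in_vars N p \<Longrightarrow> mp_in_vars N q \<Longrightarrow> mp_in_vars N (p * q)"
  using keys_mult[of p q] keys_add unfolding mp_in_vars_def by fastforce

lemma mp_in_vars_single: "Poly_Mapping.keys m \<subseteq> {..<N} \<Longrightarrow> mp_in_vars N (Poly_Mapping.single m c)"
  by (simp add: mp_in_vars_def)

lemma mp_in_vars_0 [simp]: "mp_in_vars N 0"
  by (simp add: mp_in_vars_def)

definition poly_fun :: "nat \<Rightarrow> ((nat \<Rightarrow> 'a::comm_ring_1) \<Rightarrow> 'a) \<Rightarrow> bool" where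
  "poly_fun N f \<longleftrightarrow> (\<exists>P. mp_in_vars N P \<and> (\<forall>v. mp_eval P v = f v))"

lemma poly_fun_const: "poly_fun N (\<lambda>v. c)"
  unfolding poly_fun_def
  by (intro exI[of _ "Poly_Mapping.single 0 c"]) (simp add: mp_in_vars_single mp_eval_single)

lemma poly_fun_var: "i < N \<Longrightarrow> poly_fun N (\<lambda>v. v i)"
  unfolding poly_fun_def
  by (intro exI[of _ "mp_var i"])
     (simp add: mp_in_vars_single mp_eval_single mp_var_def mono_eval_def)

lemma poly_fun_add: "poly_fun N f \<Longrightarrow> poly_fun N g \<Longrightarrow> poly_fun N (\<lambda>v. f v + g v)"
  unfolding poly_fun_def by (metis mp_eval_add mp_in_vars_add)

lemma poly_fun_mult: "poly_fun N f \<Longrightarrow> poly_fun N g \<Longrightarrow> poly_fun N (\<lambda>v. f v * g v)"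
  unfolding poly_fun_def by (metis mp_eval_mult mp_in_vars_mult)

lemma poly_fun_diff: "poly_fun N f \<Longrightarrow> poly_fun N g \<Longrightarrow> poly_fun N (\<lambda>v. f v - g v)"
  using poly_fun_add[of N f "\<lambda>v. (- 1) * g v"] poly_fun_mult[OF poly_fun_const[of N "- 1"], of g]
  by simp

lemma poly_fun_sum: "(\<And>i. i \<in> A \<Longrightarrow> poly_fun N (f i)) \<Longrightarrow> poly_fun N (\<lambda>v. \<Sum>i\<in>A. f i v)"
  by (induction A rule: infinite_finite_induct) (auto intro: poly_fun_const poly_fun_add)

definition generically :: "nat \<Rightarrow> ((nat \<Rightarrow> 'a::comm_ring_1) \<Rightarrow> bool) \<Rightarrow> bool" where
  "generically N Q \<longleftrightarrow> (\<exists>P. P \<noteq> 0 \<and> mp_in_vars N P \<and> (\<forall>v. mp_eval P v \<noteq> 0 \<longrightarrow> Q v))"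

lemma generically_mono: "generically N Q \<Longrightarrow> (\<And>v. Q v \<Longrightarrow> R v) \<Longrightarrow> generically N R"
  unfolding generically_def by blast

text \<open>The single value at \<open>v0\<close> certifies that the polynomial is not zero. This is
  how one good position yields a statement about general positions.\<close>

lemma generically_poly_fun:
  assumes "poly_fun N f" "f v0 \<noteq> 0"
  shows "generically N (\<lambda>v. f v \<noteq> 0)"
  using assms unfolding poly_fun_def generically_def by (metis mp_eval_0)

lemma generically_True: "generically N (\<lambda>v :: nat \<Rightarrow> 'a::comm_ring_1. True)"
  using generically_poly_fun[OF poly_fun_const[of N "1::'a"]] by simp

text \<open>The polynomial ring over a domain is a domain, so the product of the two polynomials is
  again nonzero: nonempty open sets meet.\<close>

lemma generically_conj:
  fixes Q R :: "(nat \<Rightarrow> 'a::idom) \<Rightarrow> bool"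
  assumes "generically N Q" "generically N R"
  shows "generically N (\<lambda>v. Q v \<and> R v)"
proof -
  obtain P P' where "P \<noteq> 0" "mp_in_vars N P" "\<And>v. mp_eval P v \<noteq> 0 \<Longrightarrow> Q v"
    "P' \<noteq> 0" "mp_in_vars N P'" "\<And>v. mp_eval P' v \<noteq> 0 \<Longrightarrow> R v"
    using assms unfolding generically_def by blast
  then show ?thesis unfolding generically_def
    by (intro exI[of _ "P * P'"]) (auto simp: mp_in_vars_mult mp_eval_mult)
qed

lemma generically_Ball:
  fixes Q :: "'b \<Rightarrow> (nat \<Rightarrow> 'a::idom) \<Rightarrow> bool"
  assumes "finite S" "\<And>s. s \<in> S \<Longrightarrow> generically N (Q s)"
  shows "generically N (\<lambda>v. \<forall>s\<in>S. Q s v)"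
  using assms
proof (induction S)
  case empty
  then show ?case by (simp add: generically_True)
next
  case (insert s S)
  then have "generically N (\<lambda>v. Q s v \<and> (\<forall>s\<in>S. Q s v))" by (intro generically_conj) auto
  then show ?case by (rule generically_mono) auto
qed

text \<open>Openness of independence, and of spanning below, by fraction-free Gaussian elimination.\<close>

lemma generically_independent:
  fixes M :: "(nat \<Rightarrow> 'a::field) \<Rightarrow> 'b \<Rightarrow> 'c \<Rightarrow> 'a"
  assumes "finite B" "\<And>b c. b \<in> B \<Longrightarrow> poly_fun N (\<lambda>v. M v b c)"
    and "\<And>x. (\<And>c. (\<Sum>b\<in>B. x b * M v0 b c) = 0) \<Longrightarrow> \<forall>b\<in>B. x b = 0"
  shows "generically N (\<lambda>v. \<forall>x. (\<forall>c. (\<Sum>b\<in>B. x b * M v b c) = 0) \<longrightarrow> (\<forall>b\<in>B. x b = 0))"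
  using assms
proof (induction B arbitrary: M)
  case empty
  then show ?case by (simp add: generically_True)
next
  case (insert b B)
  have eqs: "(\<Sum>i\<in>insert b B. x i * M v i c) = x b * M v b c + (\<Sum>i\<in>B. x i * M v i c)" for x v c
    using insert.hyps by simp
  have "\<exists>c. M v0 b c \<noteq> 0"
  proof (rule ccontr)
    assume "\<not> ?thesis"
    then have "\<forall>i\<in>insert b B. (if i = b then 1 else 0) = (0::'a)"
      using insert.hyps by (intro insert.prems(2)) (auto intro!: sum.neutral)
    then show False by simp
  qed
  then obtain c0 where c0: "M v0 b c0 \<noteq> 0" by blast
  \<comment> \<open>Cross-multiplication in place of division keeps the entries polynomial in
    \<open>v\<close>. Column \<open>c0\<close> of \<open>M'\<close> vanishes identically, and the
    pivot \<open>M v b c0\<close> becomes one more open condition.\<close>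
  define M' where "M' v i c = M v b c0 * M v i c - M v i c0 * M v b c" for v i c
  have sumM': "(\<Sum>i\<in>B. x i * M' v i c) =
      M v b c0 * (\<Sum>i\<in>B. x i * M v i c) - (\<Sum>i\<in>B. x i * M v i c0) * M v b c" for x v c
    by (simp add: M'_def sum_subtractf sum_distrib_left sum_distrib_right algebra_simps)
  have "generically N (\<lambda>v. \<forall>x. (\<forall>c. (\<Sum>i\<in>B. x i * M' v i c) = 0) \<longrightarrow> (\<forall>i\<in>B. x i = 0))"
  proof (rule insert.IH)
    show "poly_fun N (\<lambda>v. M' v i c)" if "i \<in> B" for i c
      unfolding M'_def using that by (intro poly_fun_diff poly_fun_mult insert.prems(1)) auto
  next
    fix x assume x: "\<And>c. (\<Sum>i\<in>B. x i * M' v0 i c) = 0"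
    \<comment> \<open>A relation between the rows of \<open>M'\<close> at \<open>v0\<close> lifts to
      one between the rows of \<open>M\<close>; its coefficient at \<open>b\<close> is forced by
      column \<open>c0\<close>.\<close>
    define y where "y i = (if i = b then - (\<Sum>i\<in>B. x i * M v0 i c0) else M v0 b c0 * x i)" for i
    have "(\<Sum>i\<in>insert b B. y i * M v0 i c) = 0" for c
    proof -
      have "(\<Sum>i\<in>B. y i * M v0 i c) = M v0 b c0 * (\<Sum>i\<in>B. x i * M v0 i c)"
        unfolding sum_distrib_left using insert.hyps by (intro sum.cong) (auto simp: y_def)
      then show ?thesis unfolding eqs using x[of c] unfolding sumM' by (simp add: y_def)
    qed
    then have "\<forall>i\<in>insert b B. y i = 0" by (rule insert.prems(2))
    then show "\<forall>i\<in>B. x i = 0" using c0 insert.hyps by (auto simp: y_def split: if_splits)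
  qed
  moreover have "generically N (\<lambda>v. M v b c0 \<noteq> 0)"
    using c0 by (intro generically_poly_fun[of _ _ v0] insert.prems(1)) auto
  ultimately have "generically N (\<lambda>v. (\<forall>x. (\<forall>c. (\<Sum>i\<in>B. x i * M' v i c) = 0) \<longrightarrow> (\<forall>i\<in>B. x i = 0))
      \<and> M v b c0 \<noteq> 0)"
    by (rule generically_conj)
  then show ?case
  proof (rule generically_mono, intro allI impI)
    fix v x
    assume v: "(\<forall>x. (\<forall>c. (\<Sum>i\<in>B. x i * M' v i c) = 0) \<longrightarrow> (\<forall>i\<in>B. x i = 0)) \<and> M v b c0 \<noteq> 0"
      and x: "\<forall>c. (\<Sum>i\<in>insert b B. x i * M v i c) = 0"
    have s: "(\<Sum>i\<in>B. x i * M v i c) = - (x b * M v b c)" for c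
      using x[rule_format, of c] unfolding eqs by (simp add: eq_neg_iff_add_eq_0 add.commute)
    have "(\<Sum>i\<in>B. x i * M' v i c) = 0" for c
      unfolding sumM' s by simp
    then have B: "\<forall>i\<in>B. x i = 0" using v by blast
    then have "x b * M v b c0 = 0" using s[of c0] by simp
    with v B show "\<forall>i\<in>insert b B. x i = 0" by simp
  qed
qed

lemma generically_spanning:
  fixes M :: "(nat \<Rightarrow> 'a::field) \<Rightarrow> 'b \<Rightarrow> 'c \<Rightarrow> 'a"
  assumes "finite B" "finite C" "\<And>b c. b \<in> B \<Longrightarrow> poly_fun N (\<lambda>v. M v b c)"
    and "\<And>g. \<exists>x. \<forall>c\<in>C. (\<Sum>b\<in>B. x b * M v0 b c) = g c"
  shows "generically N (\<lambda>v. \<forall>g. \<exists>x. \<forall>c\<in>C. (\<Sum>b\<in>B. x b * M v b c) = g c)"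
  using assms(2-)
proof (induction C arbitrary: M)
  case empty
  then show ?case by (simp add: generically_True)
next
  case (insert c0 C)
  have "\<exists>b\<in>B. M v0 b c0 \<noteq> 0"
  proof (rule ccontr)
    assume "\<not> ?thesis"
    then have "(\<Sum>b\<in>B. x b * M v0 b c0) = 0" for x by simp
    moreover obtain x where "\<forall>c\<in>insert c0 C. (\<Sum>b\<in>B. x b * M v0 b c) = 1"
      using insert.prems(2)[of "\<lambda>_. 1"] by blast
    ultimately show False by simp
  qed
  then obtain b where b: "b \<in> B" "M v0 b c0 \<noteq> 0" by blast
  define M' where "M' v i c = M v b c0 * M v i c - M v i c0 * M v b c" for v i c
  have sumM': "(\<Sum>i\<in>B. x i * M' v i c) =
      M v b c0 * (\<Sum>i\<in>B. x i * M v i c) - (\<Sum>i\<in>B. x i * M v i c0) * M v b c" for x v c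
    by (simp add: M'_def sum_subtractf sum_distrib_left sum_distrib_right algebra_simps)
  have "generically N (\<lambda>v. \<forall>g. \<exists>x. \<forall>c\<in>C. (\<Sum>i\<in>B. x i * M' v i c) = g c)"
  proof (rule insert.IH)
    show "poly_fun N (\<lambda>v. M' v i c)" if "i \<in> B" for i c
      unfolding M'_def using that b by (intro poly_fun_diff poly_fun_mult insert.prems(1)) auto
  next
    fix g
    \<comment> \<open>With value 0 prescribed at \<open>c0\<close> the correction term in
      \<open>sumM'\<close> disappears, and only the factor \<open>M v0 b c0\<close> has to be
      divided out.\<close>
    obtain x where x: "\<forall>c\<in>insert c0 C. (\<Sum>i\<in>B. x i * M v0 i c) = (g(c0 := 0)) c"
      using insert.prems(2) by blast
    have "(\<Sum>i\<in>B. x i / M v0 b c0 * M' v0 i c) = g c" if "c \<in> C" for c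
    proof -
      have "c \<noteq> c0" using that insert.hyps by auto
      then have "(\<Sum>i\<in>B. x i * M' v0 i c) = M v0 b c0 * g c" unfolding sumM' using x that by simp
      then show ?thesis using b by (simp add: sum_divide_distrib[symmetric])
    qed
    then show "\<exists>x. \<forall>c\<in>C. (\<Sum>i\<in>B. x i * M' v0 i c) = g c" by (intro exI[of _ "\<lambda>i. x i / M v0 b c0"]) blast
  qed
  moreover have "generically N (\<lambda>v. M v b c0 \<noteq> 0)"
    using b by (intro generically_poly_fun[of _ _ v0] insert.prems(1)) auto
  ultimately have "generically N (\<lambda>v. (\<forall>g. \<exists>x. \<forall>c\<in>C. (\<Sum>i\<in>B. x i * M' v i c) = g c)
      \<and> M v b c0 \<noteq> 0)"
    by (rule generically_conj)
  then show ?case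
  proof (rule generically_mono, intro allI)
    fix v and g :: "'c \<Rightarrow> 'a"
    assume v: "(\<forall>g. \<exists>x. \<forall>c\<in>C. (\<Sum>i\<in>B. x i * M' v i c) = g c) \<and> M v b c0 \<noteq> 0"
    \<comment> \<open>Combinations of rows of \<open>M'\<close> vanish at \<open>c0\<close>, so the
      value there has to come from row \<open>b\<close> alone; \<open>e\<close> is the multiple of
      that row that gives \<open>g c0\<close>.\<close>
    define e where "e = g c0 / M v b c0"
    obtain x where x: "\<forall>c\<in>C. (\<Sum>i\<in>B. x i * M' v i c) = g c - e * M v b c"
      using spec[OF conjunct1[OF v], of "\<lambda>c. g c - e * M v b c"] by blast
    define y where "y i = M v b c0 * x i + (if i = b then e - (\<Sum>i\<in>B. x i * M v i c0) else 0)" for i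
    have y: "(\<Sum>i\<in>B. y i * M v i c) = (\<Sum>i\<in>B. x i * M' v i c) + e * M v b c" for c
    proof -
      have "(\<Sum>i\<in>B. y i * M v i c) = (\<Sum>i\<in>B. M v b c0 * (x i * M v i c) +
          (if i = b then (e - (\<Sum>i\<in>B. x i * M v i c0)) * M v b c else 0))"
        by (intro sum.cong) (auto simp: y_def algebra_simps)
      also have "\<dots> = M v b c0 * (\<Sum>i\<in>B. x i * M v i c) + (e - (\<Sum>i\<in>B. x i * M v i c0)) * M v b c"
        using assms(1) b by (simp add: sum.distrib sum_distrib_left)
      finally show ?thesis unfolding sumM' by (simp add: algebra_simps)
    qed
    have "(\<Sum>i\<in>B. x i * M' v i c0) = 0" unfolding sumM' by simp
    then have "(\<Sum>i\<in>B. y i * M v i c0) = g c0" unfolding y using v by (simp add: e_def)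
    moreover have "(\<Sum>i\<in>B. y i * M v i c) = g c" if "c \<in> C" for c
      unfolding y using x that by simp
    ultimately show "\<exists>x. \<forall>c\<in>insert c0 C. (\<Sum>i\<in>B. x i * M v i c) = g c" by auto
  qed
qed

section \<open>Ternary forms\<close>

text \<open>Integer degrees make the graded pieces of negative degree empty, so a cofactor of degree
  \<open>int e - int (b k)\<close> is 0 when \<open>b k > e\<close>, with no truncation to guard
  against.\<close>

definition Mon :: "int \<Rightarrow> (nat \<Rightarrow>\<^sub>0 nat) set" where
  "Mon z = {m. Poly_Mapping.keys m \<subseteq> {..<3} \<and> int (mon_deg m) = z}"

lemma Rdeg_iff: "p \<in> Rdeg z \<longleftrightarrow> Poly_Mapping.keys p \<subseteq> Mon z"
  by (auto simp: Rdeg_def Mon_def mp_in_vars_def)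

lemma mon_deg_superset:
  "finite S \<Longrightarrow> Poly_Mapping.keys m \<subseteq> S \<Longrightarrow> mon_deg m = (\<Sum>i\<in>S. Poly_Mapping.lookup m i)"
  unfolding mon_deg_def by (intro sum.mono_neutral_left) (auto simp: in_keys_iff)

lemma mon_deg_add: "mon_deg (m + n) = mon_deg m + mon_deg n"
proof -
  let ?S = "Poly_Mapping.keys m \<union> Poly_Mapping.keys n"
  have "mon_deg (m + n) = (\<Sum>i\<in>?S. Poly_Mapping.lookup (m + n) i)"
    using keys_add[of m n] by (intro mon_deg_superset) auto
  also have "\<dots> = mon_deg m + mon_deg n"
    by (simp add: mon_deg_superset[of ?S] lookup_add sum.distrib)
  finally show ?thesis .
qed

lemma mon_deg_single [simp]: "mon_deg (Poly_Mapping.single i n) = n"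
  by (simp add: mon_deg_def)

lemma Mon_neg: "z < 0 \<Longrightarrow> Mon z = {}"
  by (auto simp: Mon_def)

lemma Mon_add: "m \<in> Mon y \<Longrightarrow> n \<in> Mon z \<Longrightarrow> m + n \<in> Mon (y + z)"
  using keys_add[of m n] by (auto simp: Mon_def mon_deg_add)

lemma Rdeg_neg: "z < 0 \<Longrightarrow> p \<in> Rdeg z \<Longrightarrow> p = 0"
  by (simp add: Rdeg_iff Mon_neg)

lemma Rdeg_0 [simp]: "0 \<in> Rdeg z"
  by (simp add: Rdeg_iff)

lemma Rdeg_add: "p \<in> Rdeg z \<Longrightarrow> q \<in> Rdeg z \<Longrightarrow> p + q \<in> Rdeg z"
  using keys_add[of p q] by (auto simp: Rdeg_iff)

lemma Rdeg_uminus: "p \<in> Rdeg z \<Longrightarrow> - p \<in> Rdeg z"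
  by (auto simp: Rdeg_iff in_keys_iff subset_iff)

lemma Rdeg_diff: "p \<in> Rdeg z \<Longrightarrow> q \<in> Rdeg z \<Longrightarrow> p - q \<in> Rdeg z"
  using Rdeg_add[OF _ Rdeg_uminus] by fastforce

lemma Rdeg_sum: "(\<And>i. i \<in> A \<Longrightarrow> f i \<in> Rdeg z) \<Longrightarrow> sum f A \<in> Rdeg z"
  by (induction A rule: infinite_finite_induct) (auto intro: Rdeg_add)

lemma Rdeg_mult: "p \<in> Rdeg y \<Longrightarrow> q \<in> Rdeg z \<Longrightarrow> p * q \<in> Rdeg (y + z)"
  using keys_mult[of p q] Mon_add by (fastforce simp: Rdeg_iff)

lemma Rdeg_in_vars: "p \<in> Rdeg z \<Longrightarrow> mp_in_vars 3 p"
  by (simp add: Rdeg_def)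

lemma linform_altdef: "linform u = (\<Sum>i<3. Poly_Mapping.single (Poly_Mapping.single i 1) (u i))"
  by (simp add: linform_def mp_const_def mp_var_def mult_single)

lemma linform_Rdeg: "linform u \<in> Rdeg 1"
  unfolding linform_altdef by (intro Rdeg_sum) (auto simp: Rdeg_iff Mon_def)

lemma linform_power_Rdeg: "linform u ^ n \<in> Rdeg (int n)"
proof (induction n)
  case 0
  then show ?case by (simp add: Rdeg_iff Mon_def mon_deg_def)
next
  case (Suc n)
  then show ?case using Rdeg_mult[OF linform_Rdeg[of u] Suc] by simp
qed

lemma lookup_single_mult_add:
  "Poly_Mapping.lookup (Poly_Mapping.single s c * p) (s + n) = c * Poly_Mapping.lookup p n"
  for s n :: "nat \<Rightarrow>\<^sub>0 nat"
proof -
  have "Poly_Mapping.single s c * p =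
      (\<Sum>m\<in>Poly_Mapping.keys p. Poly_Mapping.single (s + m) (c * Poly_Mapping.lookup p m))"
    by (subst (1) mpoly_expansion[OF finite_keys subset_refl, of p])
       (simp add: sum_distrib_left mult_single)
  then have "Poly_Mapping.lookup (Poly_Mapping.single s c * p) (s + n) =
      (\<Sum>m\<in>Poly_Mapping.keys p. if m = n then c * Poly_Mapping.lookup p m else 0)"
    by (simp add: lookup_sum lookup_single when_def)
  then show ?thesis by (simp add: in_keys_iff)
qed

lemma lookup_single_mult_eq_0:
  fixes m s :: "nat \<Rightarrow>\<^sub>0 nat"
  assumes "\<And>n. m \<noteq> s + n"
  shows "Poly_Mapping.lookup (Poly_Mapping.single s c * p) m = 0"
proof (rule ccontr)
  assume "\<not> ?thesis"
  then have "m \<in> Poly_Mapping.keys (Poly_Mapping.single s c * p)" by (simp add: in_keys_iff)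
  then show False using keys_mult[of "Poly_Mapping.single s c" p] assms by (auto split: if_splits)
qed

lemma lookup_var_mult:
  fixes p :: "'a::comm_ring_1 mpoly"
  shows "Poly_Mapping.lookup (Poly_Mapping.single (Poly_Mapping.single i 1) c * p) m =
    c * (if Poly_Mapping.lookup m i > 0 then Poly_Mapping.lookup p (m - Poly_Mapping.single i (1::nat)) else 0)"
proof (cases "Poly_Mapping.lookup m i > 0")
  case True
  then have "m = Poly_Mapping.single i 1 + (m - Poly_Mapping.single i 1)"
    by (intro poly_mapping_eqI) (auto simp: lookup_add lookup_minus lookup_single when_def)
  with True show ?thesis
    using lookup_single_mult_add[of "Poly_Mapping.single i 1" c p "m - Poly_Mapping.single i 1"] by simp
next
  case False
  then have "m \<noteq> Poly_Mapping.single i 1 + n" for n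
    by (auto simp: lookup_add)
  with False show ?thesis by (simp add: lookup_single_mult_eq_0)
qed

lemma lookup_linform_mult:
  "Poly_Mapping.lookup (linform u * p) m =
    (\<Sum>i<3. u i * (if Poly_Mapping.lookup m i > 0 then Poly_Mapping.lookup p (m - Poly_Mapping.single i 1) else 0))"
  by (simp only: linform_altdef sum_distrib_right lookup_sum lookup_var_mult)

text \<open>Each factor \<open>linform\<close> combines earlier coefficients with the three
  coordinates of line \<open>k\<close>. These coefficients are the matrix entries to which the
  openness lemmas are applied.\<close>

lemma poly_fun_lookup_linform_power:
  assumes "3 * k + 3 \<le> N"
  shows "poly_fun N (\<lambda>v. Poly_Mapping.lookup (linform (\<lambda>i. v (3 * k + i)) ^ n * p) m)"
proof (induction n arbitrary: m)
  case 0
  then show ?case by (simp add: poly_fun_const)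
next
  case (Suc n)
  have "poly_fun N (\<lambda>v. if Poly_Mapping.lookup m i > 0 then
      Poly_Mapping.lookup (linform (\<lambda>i. v (3 * k + i)) ^ n * p) (m - Poly_Mapping.single i 1) else 0)" for i
    using Suc poly_fun_const by (cases "Poly_Mapping.lookup m i > 0") simp_all
  then show ?case unfolding power_Suc mult.assoc lookup_linform_mult
    using assms by (intro poly_fun_sum poly_fun_mult poly_fun_var) auto
qed

definition mon :: "nat \<Rightarrow> nat \<Rightarrow> nat \<Rightarrow> nat \<Rightarrow>\<^sub>0 nat" where
  "mon i k l = Poly_Mapping.single 0 i + Poly_Mapping.single 1 k + Poly_Mapping.single 2 l"

lemma lookup_mon:
  "Poly_Mapping.lookup (mon i k l) n = (if n = 0 then i else if n = 1 then k else if n = 2 then l else 0)"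
  by (auto simp: mon_def lookup_add lookup_single when_def)

lemma mon_eq_iff [simp]: "mon i k l = mon i' k' l' \<longleftrightarrow> i = i' \<and> k = k' \<and> l = l'"
proof
  assume "mon i k l = mon i' k' l'"
  then have "Poly_Mapping.lookup (mon i k l) n = Poly_Mapping.lookup (mon i' k' l') n" for n by simp
  from this[of 0] this[of 1] this[of 2] show "i = i' \<and> k = k' \<and> l = l'" by (simp add: lookup_mon)
qed simp

lemma mon_diff_single:
  "mon i k l - Poly_Mapping.single 0 (Suc 0) = mon (i - 1) k l"
  "mon i k l - Poly_Mapping.single (Suc 0) (Suc 0) = mon i (k - 1) l"
  "mon i k l - Poly_Mapping.single 2 (Suc 0) = mon i k (l - 1)"
  by (intro poly_mapping_eqI; auto simp: lookup_minus lookup_single lookup_mon when_def)+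

lemma mon_deg_mon: "mon_deg (mon i k l) = i + k + l"
  by (simp add: mon_def mon_deg_add)

lemma mon_in_Mon [simp]: "mon i k l \<in> Mon z \<longleftrightarrow> int (i + k + l) = z"
  by (auto simp: Mon_def mon_deg_mon in_keys_iff lookup_mon split: if_splits)

lemma Mon_cases:
  assumes "m \<in> Mon z"
  obtains i k l where "m = mon i k l" "int (i + k + l) = z"
proof -
  have "m = mon (Poly_Mapping.lookup m 0) (Poly_Mapping.lookup m 1) (Poly_Mapping.lookup m 2)"
    using assms unfolding Mon_def
    by (intro poly_mapping_eqI) (auto simp: lookup_mon in_keys_iff subset_iff numeral_3_eq_3 numeral_2_eq_2 less_Suc_eq)
  then show ?thesis using that assms by (metis mon_in_Mon)
qed

lemma finite_Mon: "finite (Mon z)"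
proof (rule finite_subset)
  show "Mon z \<subseteq> (\<lambda>(i, k, l). mon i k l) ` ({..nat z} \<times> {..nat z} \<times> {..nat z})"
  proof
    fix m assume "m \<in> Mon z"
    then obtain i k l where "m = mon i k l" "int (i + k + l) = z" by (rule Mon_cases)
    then show "m \<in> (\<lambda>(i, k, l). mon i k l) ` ({..nat z} \<times> {..nat z} \<times> {..nat z})"
      by (intro image_eqI[of _ _ "(i, k, l)"]) auto
  qed
qed simp

lemma lookup_linform_mult_mon:
  "Poly_Mapping.lookup (linform u * p) (mon i k l) =
    u 0 * (if i > 0 then Poly_Mapping.lookup p (mon (i - 1) k l) else 0) +
    u 1 * (if k > 0 then Poly_Mapping.lookup p (mon i (k - 1) l) else 0) +
    u 2 * (if l > 0 then Poly_Mapping.lookup p (mon i k (l - 1)) else 0)"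
proof -
  have "{..<3} = {0, 1, 2::nat}" by auto
  then show ?thesis by (simp add: lookup_linform_mult lookup_mon mon_diff_single)
qed

text \<open>The coefficient of \<open>x\<^sup>i\<close> in a form of degree \<open>e\<close>, dehomogenized at \<open>z = 1\<close>.\<close>

definition layer :: "nat \<Rightarrow> nat \<Rightarrow> 'a::comm_ring_1 mpoly \<Rightarrow> 'a poly" where
  "layer e i p = (\<Sum>k<e + 1 - i. monom (Poly_Mapping.lookup p (mon i k (e - i - k))) k)"

lemma coeff_layer:
  "coeff (layer e i p) k = (if i + k \<le> e then Poly_Mapping.lookup p (mon i k (e - i - k)) else 0)"
proof -
  have "coeff (layer e i p) k =
      (if k < e + 1 - i then Poly_Mapping.lookup p (mon i k (e - i - k)) else 0)"
    by (simp add: layer_def coeff_sum coeff_monom)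
  then show ?thesis by auto
qed

lemma deg_lt_layer: "deg_lt (layer e i p) (e + 1 - i)"
  by (auto simp: deg_lt_def coeff_layer)

lemma layer_add: "layer e i (p + q) = layer e i p + layer e i q"
  by (intro poly_eqI) (simp add: coeff_layer lookup_add)

lemma layer_0 [simp]: "layer e i 0 = 0"
  by (intro poly_eqI) (simp add: coeff_layer)

lemma layer_sum: "layer e i (sum f A) = (\<Sum>k\<in>A. layer e i (f k))"
  by (induction A rule: infinite_finite_induct) (simp_all add: layer_add)

lemma coeff_lin_mult: "coeff (lin t * p) k = (if k > 0 then coeff p (k - 1) else 0) - t * coeff p k"
  by (cases k) (simp_all add: lin_def)

lemma layer_linform_mult:
  assumes "u 1 = 1" "u 2 = - t"
  shows "layer (Suc e) 0 (linform u * p) = lin t * layer e 0 p"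
    and "layer (Suc e) 1 (linform u * p) = lin t * layer e 1 p + smult (u 0) (layer e 0 p)"
proof -
  have "coeff (layer (Suc e) 0 (linform u * p)) k = coeff (lin t * layer e 0 p) k" for k
    using assms unfolding coeff_layer coeff_lin_mult lookup_linform_mult_mon
    by (cases k) (auto simp: Suc_diff_le)
  then show "layer (Suc e) 0 (linform u * p) = lin t * layer e 0 p" by (rule poly_eqI)
  have "coeff (layer (Suc e) 1 (linform u * p)) k
      = coeff (lin t * layer e 1 p + smult (u 0) (layer e 0 p)) k" for k
    using assms unfolding coeff_add coeff_smult coeff_layer coeff_lin_mult lookup_linform_mult_mon
    by (cases k) (auto simp: Suc_diff_le)
  then show "layer (Suc e) 1 (linform u * p) = lin t * layer e 1 p + smult (u 0) (layer e 0 p)"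
    by (rule poly_eqI)
qed

lemma layer_linform_power_mult:
  fixes p :: "'a::idom mpoly"
  assumes "u 1 = 1" "u 2 = - t"
  shows "layer (n + e) 0 (linform u ^ n * p) = lin t ^ n * layer e 0 p"
    and "layer (n + e) 1 (linform u ^ n * p) =
      lin t ^ n * layer e 1 p + smult (of_nat n * u 0) (lin t ^ (n - 1) * layer e 0 p)"
proof -
  show 1: "layer (n + e) 0 (linform u ^ n * p) = lin t ^ n * layer e 0 p" for n
    by (induction n) (simp_all add: mult.assoc layer_linform_mult[OF assms])
  show "layer (n + e) 1 (linform u ^ n * p) =
      lin t ^ n * layer e 1 p + smult (of_nat n * u 0) (lin t ^ (n - 1) * layer e 0 p)"
  proof (induction n)
    case (Suc n)
    \<comment> \<open>The truncated exponent \<open>n - 1\<close> at \<open>n = 0\<close> is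
      harmless, because the scalar \<open>of_nat n\<close> is 0 there.\<close>
    have "lin t * smult (of_nat n * u 0) (lin t ^ (n - 1) * layer e 0 p)
        = smult (of_nat n * u 0) (lin t ^ n * layer e 0 p)"
      by (cases n) (simp_all add: mult.assoc)
    moreover have "layer (Suc n + e) 1 (linform u ^ Suc n * p)
        = lin t * layer (n + e) 1 (linform u ^ n * p) + smult (u 0) (lin t ^ n * layer e 0 p)"
      unfolding 1[symmetric] using layer_linform_mult(2)[OF assms, of "n + e" "linform u ^ n * p"]
      by (simp add: mult.assoc)
    ultimately show ?case unfolding Suc
      by (simp add: distrib_left mult.assoc smult_add_left distrib_right)
  qed simp
qed

text \<open>The section of the two \<open>layer\<close> maps with no monomial divisible by
  \<open>x^2\<close>; it turns solutions for binary forms into cofactors.\<close>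

definition from_layers :: "nat \<Rightarrow> 'a::comm_ring_1 poly \<Rightarrow> 'a poly \<Rightarrow> 'a mpoly" where
  "from_layers e p q = (\<Sum>k<Suc e. Poly_Mapping.single (mon 0 k (e - k)) (coeff p k)) +
     (\<Sum>k<e. Poly_Mapping.single (mon 1 k (e - 1 - k)) (coeff q k))"

lemma keys_from_layers: "Poly_Mapping.keys (from_layers e p q) \<subseteq> {m \<in> Mon (int e). Poly_Mapping.lookup m 0 \<le> 1}"
proof
  fix m assume "m \<in> Poly_Mapping.keys (from_layers e p q)"
  then have "Poly_Mapping.lookup (from_layers e p q) m \<noteq> 0" by (simp add: in_keys_iff)
  then have "(\<Sum>k<Suc e. Poly_Mapping.lookup (Poly_Mapping.single (mon 0 k (e - k)) (coeff p k)) m) \<noteq> 0 \<or>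
     (\<Sum>k<e. Poly_Mapping.lookup (Poly_Mapping.single (mon 1 k (e - 1 - k)) (coeff q k)) m) \<noteq> 0"
    by (auto simp: from_layers_def lookup_add lookup_sum)
  then obtain k where "k < Suc e \<and> m = mon 0 k (e - k) \<or> k < e \<and> m = mon 1 k (e - 1 - k)"
    by (metis (no_types, lifting) lookup_single_not_eq sum.neutral lessThan_iff)
  then show "m \<in> {m \<in> Mon (int e). Poly_Mapping.lookup m 0 \<le> 1}" by (auto simp: lookup_mon)
qed

lemma layer_from_layers:
  assumes "deg_lt p (Suc e)" "deg_lt q e"
  shows "layer e 0 (from_layers e p q) = p" and "layer e 1 (from_layers e p q) = q"
proof -
  have single: "Poly_Mapping.lookup (Poly_Mapping.single (mon i k l) c) (mon i' k' l') =
      (if k = k' then if i = i' \<and> l = l' then c else 0 else 0)" for i k l i' k' l' and c :: 'a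
    by (simp add: lookup_single when_def)
  have "coeff (layer e 0 (from_layers e p q)) k = coeff p k" for k
    using assms(1) by (simp add: coeff_layer from_layers_def lookup_add lookup_sum single deg_lt_def)
  then show "layer e 0 (from_layers e p q) = p" by (rule poly_eqI)
  have "coeff (layer e 1 (from_layers e p q)) k = coeff q k" for k
    using assms(2) by (simp add: coeff_layer from_layers_def lookup_add lookup_sum single deg_lt_def)
  then show "layer e 1 (from_layers e p q) = q" by (rule poly_eqI)
qed

lemma lookup_eq_0_of_layers:
  assumes "layer e 0 p = 0" "layer e 1 p = 0" "m \<in> Mon (int e)" "Poly_Mapping.lookup m 0 \<le> 1"
  shows "Poly_Mapping.lookup p m = 0"
proof -
  obtain i k l where m: "m = mon i k l" "i + k + l = e" using assms(3) by (auto elim: Mon_cases)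
  then have "i = 0 \<or> i = 1" using assms(4) by (auto simp: lookup_mon)
  moreover have "coeff (layer e i p) k = Poly_Mapping.lookup p m"
    unfolding coeff_layer using m by auto
  ultimately show ?thesis using assms(1,2) by auto
qed

section \<open>Cofactors as the unknowns of a linear system\<close>

lemma lookup_combination:
  fixes Q w :: "'k \<Rightarrow> 'a::comm_ring_1 mpoly"
  assumes "finite K" "\<And>k. k \<in> K \<Longrightarrow> finite (M k)" "\<And>k. k \<in> K \<Longrightarrow> Poly_Mapping.keys (w k) \<subseteq> M k"
  shows "Poly_Mapping.lookup (\<Sum>k\<in>K. Q k * w k) c =
    (\<Sum>(k, m)\<in>Sigma K M. Poly_Mapping.lookup (w k) m * Poly_Mapping.lookup (Q k * Poly_Mapping.single m 1) c)"
proof -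
  have "Poly_Mapping.lookup (Q k * w k) c =
      (\<Sum>m\<in>M k. Poly_Mapping.lookup (w k) m * Poly_Mapping.lookup (Q k * Poly_Mapping.single m 1) c)"
    if k: "k \<in> K" for k
  proof -
    have "Poly_Mapping.single m a = Poly_Mapping.single 0 a * Poly_Mapping.single m 1" for m and a :: 'a
      by (simp add: mult_single)
    then have "Q k * w k =
        (\<Sum>m\<in>M k. Poly_Mapping.single 0 (Poly_Mapping.lookup (w k) m) * (Q k * Poly_Mapping.single m 1))"
      using mpoly_expansion[OF assms(2,3)[OF k]] by (metis (no_types, lifting) mult.left_commute sum.cong sum_distrib_left)
    moreover have "Poly_Mapping.lookup (Poly_Mapping.single 0 a * p) c = a * Poly_Mapping.lookup p c"
      for a and p :: "'a mpoly"
      using lookup_single_mult_add[of 0 a p c] by simp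
    ultimately show ?thesis by (simp add: lookup_sum)
  qed
  then show ?thesis using assms(1,2) by (simp add: lookup_sum sum.Sigma)
qed

definition combination_of :: "('k \<Rightarrow> (nat \<Rightarrow>\<^sub>0 nat) set) \<Rightarrow> ('k \<times> (nat \<Rightarrow>\<^sub>0 nat) \<Rightarrow> 'a::comm_ring_1) \<Rightarrow> 'k \<Rightarrow> 'a mpoly" where
  "combination_of M x k = (\<Sum>m\<in>M k. Poly_Mapping.single m (x (k, m)))"

lemma lookup_combination_of:
  "finite (M k) \<Longrightarrow> m \<in> M k \<Longrightarrow> Poly_Mapping.lookup (combination_of M x k) m = x (k, m)"
  by (simp add: combination_of_def lookup_sum lookup_single when_def)

lemma keys_combination_of: "Poly_Mapping.keys (combination_of M x k) \<subseteq> M k"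
proof
  fix m assume "m \<in> Poly_Mapping.keys (combination_of M x k)"
  then have "(\<Sum>n\<in>M k. Poly_Mapping.lookup (Poly_Mapping.single n (x (k, n))) m) \<noteq> 0"
    by (simp add: combination_of_def in_keys_iff lookup_sum)
  then show "m \<in> M k" by (metis (no_types, lifting) lookup_single_not_eq sum.neutral)
qed

text \<open>The unknowns are the coefficients of the cofactors, one for each pair of a generator and
  an allowed monomial; every monomial \<open>c\<close> gives one equation. Vanishing of all
  coefficients is independence of the rows, an open condition.\<close>

lemma generically_forms_independent:
  fixes Q :: "(nat \<Rightarrow> 'a::field) \<Rightarrow> 'k \<Rightarrow> 'a mpoly"
  assumes "finite K" "\<And>k. k \<in> K \<Longrightarrow> finite (M k)"
    and "\<And>k m c. k \<in> K \<Longrightarrow> m \<in> M k \<Longrightarrow> poly_fun N (\<lambda>v. Poly_Mapping.lookup (Q v k * Poly_Mapping.single m 1) c)"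
    and ind: "\<And>w. (\<And>k. k \<in> K \<Longrightarrow> Poly_Mapping.keys (w k) \<subseteq> M k) \<Longrightarrow> (\<Sum>k\<in>K. Q v0 k * w k) = 0 \<Longrightarrow> \<forall>k\<in>K. w k = 0"
  shows "generically N (\<lambda>v. \<forall>w. (\<forall>k\<in>K. Poly_Mapping.keys (w k) \<subseteq> M k) \<longrightarrow>
    (\<Sum>k\<in>K. Q v k * w k) = 0 \<longrightarrow> (\<forall>k\<in>K. w k = 0))"
proof -
  define B where "B = Sigma K M"
  define X where "X v = (\<lambda>(k, m) c. Poly_Mapping.lookup (Q v k * Poly_Mapping.single m 1) c)" for v
  have fin: "finite B" unfolding B_def using assms(1,2) by auto
  have "generically N (\<lambda>v. \<forall>x. (\<forall>c. (\<Sum>b\<in>B. x b * X v b c) = 0) \<longrightarrow> (\<forall>b\<in>B. x b = 0))"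
  proof (rule generically_independent[OF fin])
    show "poly_fun N (\<lambda>v. X v b c)" if "b \<in> B" for b c
      using that assms(3) by (auto simp: B_def X_def)
  next
    fix x assume x: "\<And>c. (\<Sum>b\<in>B. x b * X v0 b c) = 0"
    define w where "w = combination_of M x"
    have lw: "Poly_Mapping.lookup (w k) m = x (k, m)" if "k \<in> K" "m \<in> M k" for k m
      using that assms(2) by (simp add: w_def lookup_combination_of)
    have "Poly_Mapping.lookup (\<Sum>k\<in>K. Q v0 k * w k) c = (\<Sum>b\<in>B. x b * X v0 b c)" for c
      by (subst lookup_combination[where M = M, OF assms(1,2)])
         (auto simp: w_def keys_combination_of B_def X_def lookup_combination_of assms(2) intro!: sum.cong)
    then have "(\<Sum>k\<in>K. Q v0 k * w k) = 0" using x by (intro poly_mapping_eqI) simp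
    then have "\<forall>k\<in>K. w k = 0" by (intro ind) (simp_all add: w_def keys_combination_of)
    then show "\<forall>b\<in>B. x b = 0" using lw by (auto simp: B_def)
  qed
  then show ?thesis
  proof (rule generically_mono, intro allI impI ballI)
    fix v w k
    assume v: "\<forall>x. (\<forall>c. (\<Sum>b\<in>B. x b * X v b c) = 0) \<longrightarrow> (\<forall>b\<in>B. x b = 0)"
      and w: "\<forall>k\<in>K. Poly_Mapping.keys (w k) \<subseteq> M k" "(\<Sum>k\<in>K. Q v k * w k) = 0" and k: "k \<in> K"
    have "(\<Sum>b\<in>B. (case b of (k, m) \<Rightarrow> Poly_Mapping.lookup (w k) m) * X v b c) = 0" for c
      using lookup_combination[where M = M and w = w and Q = "Q v" and c = c, OF assms(1,2)] w
      by (simp add: B_def X_def case_prod_unfold)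
    then have "\<forall>b\<in>B. (case b of (k, m) \<Rightarrow> Poly_Mapping.lookup (w k) m) = 0" using v by blast
    then have "\<forall>m\<in>M k. Poly_Mapping.lookup (w k) m = 0" using k by (auto simp: B_def)
    then show "w k = 0" using w(1) k by (metis (no_types, lifting) in_keys_iff lookup_zero poly_mapping_eqI subsetD)
  qed
qed

text \<open>The same matrix, now with its columns cut down to the finite set \<open>C\<close>. The
  assumption \<open>inC\<close> guarantees for every \<open>v\<close> that no coefficient outside
  \<open>C\<close> can arise.\<close>

lemma generically_forms_span:
  fixes Q :: "(nat \<Rightarrow> 'a::field) \<Rightarrow> 'k \<Rightarrow> 'a mpoly"
  assumes "finite K" "\<And>k. k \<in> K \<Longrightarrow> finite (M k)" "finite C"
    and "\<And>k m c. k \<in> K \<Longrightarrow> m \<in> M k \<Longrightarrow> poly_fun N (\<lambda>v. Poly_Mapping.lookup (Q v k * Poly_Mapping.single m 1) c)"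
    and inC: "\<And>v k w. k \<in> K \<Longrightarrow> Poly_Mapping.keys w \<subseteq> M k \<Longrightarrow> Poly_Mapping.keys (Q v k * w) \<subseteq> C"
    and span: "\<And>g. Poly_Mapping.keys g \<subseteq> C \<Longrightarrow>
      \<exists>w. (\<forall>k\<in>K. Poly_Mapping.keys (w k) \<subseteq> M k) \<and> g = (\<Sum>k\<in>K. Q v0 k * w k)"
  shows "generically N (\<lambda>v. \<forall>g. Poly_Mapping.keys g \<subseteq> C \<longrightarrow>
    (\<exists>w. (\<forall>k\<in>K. Poly_Mapping.keys (w k) \<subseteq> M k) \<and> g = (\<Sum>k\<in>K. Q v k * w k)))"
proof -
  define B where "B = Sigma K M"
  define X where "X v = (\<lambda>(k, m) c. Poly_Mapping.lookup (Q v k * Poly_Mapping.single m 1) c)" for v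
  have fin: "finite B" unfolding B_def using assms(1,2) by auto
  have "generically N (\<lambda>v. \<forall>g. \<exists>x. \<forall>c\<in>C. (\<Sum>b\<in>B. x b * X v b c) = g c)"
  proof (rule generically_spanning[OF fin assms(3)])
    show "poly_fun N (\<lambda>v. X v b c)" if "b \<in> B" for b c
      using that assms(4) by (auto simp: B_def X_def)
  next
    fix h :: "(nat \<Rightarrow>\<^sub>0 nat) \<Rightarrow> 'a"
    \<comment> \<open>The one-element index type \<open>unit\<close> serves only to build a single
      form with prescribed coefficients on \<open>C\<close>.\<close>
    define g where "g = combination_of (\<lambda>_::unit. C) (\<lambda>(_, m). h m) ()"
    have "Poly_Mapping.keys g \<subseteq> C"
      unfolding g_def by (rule keys_combination_of)
    then obtain w where w: "\<forall>k\<in>K. Poly_Mapping.keys (w k) \<subseteq> M k" "g = (\<Sum>k\<in>K. Q v0 k * w k)"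
      using span by blast
    have "(\<Sum>b\<in>B. (case b of (k, m) \<Rightarrow> Poly_Mapping.lookup (w k) m) * X v0 b c) = h c" if "c \<in> C" for c
    proof -
      have "h c = Poly_Mapping.lookup g c"
        using that assms(3) by (simp add: g_def lookup_combination_of)
      then show ?thesis
        using lookup_combination[where M = M and w = w and Q = "Q v0" and c = c, OF assms(1,2)] w
        by (simp add: B_def X_def case_prod_unfold)
    qed
    then show "\<exists>x. \<forall>c\<in>C. (\<Sum>b\<in>B. x b * X v0 b c) = h c" by blast
  qed
  then show ?thesis
  proof (rule generically_mono, intro allI impI)
    fix v and g :: "'a mpoly"
    assume v: "\<forall>g. \<exists>x. \<forall>c\<in>C. (\<Sum>b\<in>B. x b * X v b c) = g c" and g: "Poly_Mapping.keys g \<subseteq> C"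
    obtain x where x: "\<forall>c\<in>C. (\<Sum>b\<in>B. x b * X v b c) = Poly_Mapping.lookup g c"
      using v by blast
    define w where "w = combination_of M x"
    have s: "Poly_Mapping.lookup (\<Sum>k\<in>K. Q v k * w k) c = (\<Sum>b\<in>B. x b * X v b c)" for c
      by (subst lookup_combination[where M = M, OF assms(1,2)])
         (auto simp: w_def keys_combination_of B_def X_def lookup_combination_of assms(2) intro!: sum.cong)
    have w: "Poly_Mapping.keys (w k) \<subseteq> M k" for k by (simp add: w_def keys_combination_of)
    have "Poly_Mapping.lookup g c = Poly_Mapping.lookup (\<Sum>k\<in>K. Q v k * w k) c" for c
    proof (cases "c \<in> C")
      case True
      then show ?thesis using x s by simp
    next
      case False
      \<comment> \<open>The linear system says nothing about monomials outside \<open>C\<close>,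
        where both sides vanish.\<close>
      then have "Poly_Mapping.lookup (Q v k * w k) c = 0" if "k \<in> K" for k
        using inC[OF that w[of k], of v] False by (metis in_keys_iff subsetD)
      then show ?thesis using False g by (auto simp: lookup_sum in_keys_iff)
    qed
    then have "g = (\<Sum>k\<in>K. Q v k * w k)" by (rule poly_mapping_eqI)
    with w show "\<exists>w. (\<forall>k\<in>K. Poly_Mapping.keys (w k) \<subseteq> M k) \<and> g = (\<Sum>k\<in>K. Q v k * w k)" by blast
  qed
qed

section \<open>The special position\<close>

definition line :: "(nat \<Rightarrow> 'a::comm_ring_1) \<Rightarrow> nat \<Rightarrow> 'a mpoly" where
  "line v k = linform (\<lambda>i. v (3 * k + i))"

text \<open>The lines \<open>x\<close> and \<open>c k x + y - k z\<close> for \<open>k \<ge> 1\<close>.\<close>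

definition special :: "(nat \<Rightarrow> 'a::comm_ring_1) \<Rightarrow> nat \<Rightarrow> 'a" where
  "special c n = (if n < 3 then if n = 0 then 1 else 0
     else if n mod 3 = 0 then c (n div 3) else if n mod 3 = 1 then 1 else - of_nat (n div 3))"

lemma special_0: "special c (3 * 0 + 0) = 1" "special c (3 * 0 + 1) = 0" "special c (3 * 0 + 2) = 0"
  by (simp_all add: special_def)

lemma special_pos:
  assumes "k > 0"
  shows "special c (3 * k + 0) = c k" "special c (3 * k + 1) = 1" "special c (3 * k + 2) = - of_nat k"
proof -
  have "(3 * k + 2) div 3 = k" "(3 * k + 2) mod 3 = 2" "(3 * k + 1) div 3 = k" "(3 * k + 1) mod 3 = 1"
    by presburger+
  with assms show "special c (3 * k + 0) = c k" "special c (3 * k + 1) = 1" "special c (3 * k + 2) = - of_nat k"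
    by (simp_all only: special_def) simp_all
qed

lemma lookup_square_special:
  "Poly_Mapping.lookup (line (special c) 0 ^ 2 * p) (mon i k l) =
    (if i \<ge> 2 then Poly_Mapping.lookup p (mon (i - 2) k l) else 0)"
  unfolding power2_eq_square mult.assoc line_def lookup_linform_mult_mon special_0
  by (auto simp: numeral_2_eq_2)

lemma layer_square_special: "i \<le> 1 \<Longrightarrow> layer e i (line (special c) 0 ^ 2 * p) = 0"
  by (intro poly_eqI) (simp add: coeff_layer lookup_square_special)

text \<open>In the special position \<open>L_0\<close> is the variable \<open>x\<close>, so dividing
  by its square is a shift of exponents. This lets the cofactor of \<open>L_0^2\<close> absorb
  whatever remains once the two lower layers agree.\<close>

lemma square_special_factor:
  assumes R: "R \<in> Rdeg (int e)"
    and low: "\<And>m. m \<in> Mon (int e) \<Longrightarrow> Poly_Mapping.lookup m 0 \<le> 1 \<Longrightarrow> Poly_Mapping.lookup R m = 0"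
  shows "\<exists>w \<in> Rdeg (int e - 2). R = line (special c) 0 ^ 2 * w"
proof -
  define w where "w = combination_of (\<lambda>_::unit. Mon (int e - 2))
    (\<lambda>(_, m). Poly_Mapping.lookup R (m + mon 2 0 0)) ()"
  have w: "w \<in> Rdeg (int e - 2)" unfolding Rdeg_iff w_def by (rule keys_combination_of)
  have lw: "Poly_Mapping.lookup w m = Poly_Mapping.lookup R (m + mon 2 0 0)"
    if "m \<in> Mon (int e - 2)" for m
    using that by (simp add: w_def lookup_combination_of finite_Mon)
  have sw: "line (special c) 0 ^ 2 * w \<in> Rdeg (int e)"
    using Rdeg_mult[OF linform_power_Rdeg[of _ 2] w] by (simp add: line_def)
  have "Poly_Mapping.lookup R m = Poly_Mapping.lookup (line (special c) 0 ^ 2 * w) m" for m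
  proof (cases "m \<in> Mon (int e)")
    case True
    then obtain i k l where m: "m = mon i k l" "int (i + k + l) = int e" by (rule Mon_cases)
    show ?thesis
    proof (cases "i \<ge> 2")
      case True
      then have eq: "mon (i - 2) k l + mon 2 0 0 = mon i k l"
        by (intro poly_mapping_eqI) (auto simp: lookup_add lookup_mon)
      have "mon (i - 2) k l \<in> Mon (int e - 2)" using True m by (simp add: of_nat_diff)
      from lw[OF this] show ?thesis
        using True by (simp add: eq m lookup_square_special)
    next
      case False
      then have "Poly_Mapping.lookup R m = 0" using low[OF True] by (simp add: m lookup_mon)
      then show ?thesis using False by (simp add: m lookup_square_special)
    qed
  next
    case False
    with R sw have "m \<notin> Poly_Mapping.keys R" "m \<notin> Poly_Mapping.keys (line (special c) 0 ^ 2 * w)"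
      unfolding Rdeg_iff by blast+
    then show ?thesis by (simp add: in_keys_iff)
  qed
  then have "R = line (special c) 0 ^ 2 * w" by (rule poly_mapping_eqI)
  with w show ?thesis by blast
qed

text \<open>Cofactors of the lines with \<open>k \<noteq> 0\<close> matter only modulo
  \<open>L_0^2\<close>: a multiple of \<open>x^2\<close> in one of them would give a trivial
  relation with the generator of index 0. The cofactor of \<open>L_0^2\<close> itself is
  unrestricted.\<close>

definition reduced_mons :: "nat \<Rightarrow> (nat \<Rightarrow> nat) \<Rightarrow> nat \<Rightarrow> (nat \<Rightarrow>\<^sub>0 nat) set" where
  "reduced_mons e b k = {m \<in> Mon (int e - int (b k)). k \<noteq> 0 \<longrightarrow> Poly_Mapping.lookup m 0 \<le> 1}"

lemma finite_reduced_mons: "finite (reduced_mons e b k)"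
  by (simp add: reduced_mons_def finite_Mon)

lemma reduced_mons_Rdeg: "Poly_Mapping.keys w \<subseteq> reduced_mons e b k \<Longrightarrow> w \<in> Rdeg (int e - int (b k))"
  by (auto simp: Rdeg_iff reduced_mons_def)

lemma power_mult_Rdeg:
  "Poly_Mapping.keys w \<subseteq> reduced_mons e b k \<Longrightarrow> line v k ^ b k * w \<in> Rdeg (int e)"
  using Rdeg_mult[OF linform_power_Rdeg reduced_mons_Rdeg, of w e b k "\<lambda>i. v (3 * k + i)" "b k"]
  by (simp add: line_def)

lemma inj_on_of_nat: "inj_on (of_nat :: nat \<Rightarrow> 'a::semiring_char_0) K"
  by (simp add: inj_on_def)

lemma layer_special:
  fixes w :: "'a::field_char_0 mpoly"
  assumes "k > 0" "n \<le> e"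
  shows "layer e 0 (line (special c) k ^ n * w) = lin (of_nat k) ^ n * layer (e - n) 0 w"
    and "layer e 1 (line (special c) k ^ n * w) =
      lin (of_nat k) ^ n * layer (e - n) 1 w + smult (of_nat n * c k) (lin (of_nat k) ^ (n - 1) * layer (e - n) 0 w)"
  using layer_linform_power_mult[of "\<lambda>i. special c (3 * k + i)" "of_nat k" n "e - n" w]
    assms special_pos[OF assms(1), of c] by (simp_all add: line_def)

text \<open>Layers 0 and 1 do not see the \<open>L_0^2\<close> summand, so the binary result kills
  both layers of every other cofactor. Reduced cofactors have no further layers; then only
  \<open>L_0^2 * w 0 = 0\<close> is left, in a domain.\<close>

lemma special_independent:
  assumes "double_line_pairs (of_nat :: nat \<Rightarrow> 'a::field_char_0) b e K A" "0 \<notin> K" "b 0 = 2"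
    and "(\<Sum>k\<in>K. 2 * (e - b k) + 1) \<le> 2 * e + 1"
    and w: "\<And>k. k \<in> insert 0 K \<Longrightarrow> Poly_Mapping.keys (w k) \<subseteq> reduced_mons e b k"
    and sum0: "(\<Sum>k\<in>insert 0 K. line (special (double_line_pairs.c A)) k ^ b k * w k) = (0 :: 'a mpoly)"
  shows "\<forall>k\<in>insert 0 K. w k = 0"
proof -
  interpret D: double_line_pairs "of_nat :: nat \<Rightarrow> 'a" b e K A by fact
  have s: "line (special D.c) 0 ^ 2 * w 0 + (\<Sum>k\<in>K. line (special D.c) k ^ b k * w k) = 0"
    using sum0 assms(2,3) D.finite_K by simp
  have pos: "k > 0" if "k \<in> K" for k using assms(2) that by (metis gr0I)
  have l: "(\<Sum>k\<in>K. layer e i (line (special D.c) k ^ b k * w k)) = 0" if "i \<le> 1" for i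
    using arg_cong[OF s, of "layer e i"] that by (simp add: layer_add layer_sum layer_square_special)
  have layers0: "layer (e - b k) 0 (w k) = 0 \<and> layer (e - b k) 1 (w k) = 0" if k: "k \<in> K" for k
  proof (rule D.independent[OF assms(4) _ _ _ _ k])
    fix k assume k: "k \<in> K"
    show "deg_lt (layer (e - b k) 0 (w k)) (e + 1 - b k)"
      using deg_lt_layer[of "e - b k" 0 "w k"] D.a_le[OF k] by (simp add: Suc_diff_le)
    show "deg_lt (layer (e - b k) 1 (w k)) (e - b k)"
      using deg_lt_layer[of "e - b k" 1 "w k"] by simp
  next
    show "(\<Sum>k\<in>K. lin (of_nat k) ^ b k * layer (e - b k) 0 (w k)) = 0"
      using l[of 0] pos D.a_le by (simp add: layer_special)
    show "(\<Sum>k\<in>K. lin (of_nat k) ^ b k * layer (e - b k) 1 (w k) +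
        smult (of_nat (b k) * D.c k) (lin (of_nat k) ^ (b k - 1) * layer (e - b k) 0 (w k))) = 0"
      using l[of 1] pos D.a_le by (simp add: layer_special(2)[unfolded One_nat_def])
  qed
  then have z: "w k = 0" if k: "k \<in> K" for k
  proof -
    have "Poly_Mapping.lookup (w k) m = 0" if "m \<in> Poly_Mapping.keys (w k)" for m
      using w[of k] that k pos[OF k] D.a_le[OF k] layers0[OF k]
      by (intro lookup_eq_0_of_layers[of "e - b k"]) (auto simp: reduced_mons_def of_nat_diff)
    then show ?thesis by (metis in_keys_iff lookup_zero poly_mapping_eqI)
  qed
  then have "line (special D.c) 0 ^ 2 * w 0 = 0" using s by simp
  moreover have "line (special D.c) 0 \<noteq> 0"
  proof
    assume "line (special D.c) 0 = 0"
    then have "Poly_Mapping.lookup (line (special D.c) 0 ^ 2 * 1) (mon 2 0 0) = 0" by simp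
    moreover have "mon 0 0 0 = 0" by (simp add: mon_def)
    ultimately show False unfolding lookup_square_special by simp
  qed
  ultimately have "w 0 = 0" by simp
  with z show ?thesis by blast
qed

text \<open>The binary result matches layers 0 and 1 of \<open>g\<close> by reduced cofactors; the
  difference is divisible by \<open>x^2\<close> and becomes the cofactor at index 0.\<close>

lemma special_span:
  assumes "double_line_pairs (of_nat :: nat \<Rightarrow> 'a::field_char_0) b e K A" "0 \<notin> K" "b 0 = 2"
    and "2 * e + 1 \<le> (\<Sum>k\<in>K. 2 * (e - b k) + 1)"
    and g: "(g :: 'a mpoly) \<in> Rdeg (int e)"
  shows "\<exists>w. (\<forall>k\<in>insert 0 K. Poly_Mapping.keys (w k) \<subseteq> reduced_mons e b k) \<and>
    g = (\<Sum>k\<in>insert 0 K. line (special (double_line_pairs.c A)) k ^ b k * w k)"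
proof -
  interpret D: double_line_pairs "of_nat :: nat \<Rightarrow> 'a" b e K A by fact
  have pos: "k > 0" if "k \<in> K" for k using assms(2) that by (metis gr0I)
  have "deg_lt (layer e 0 g) (e + 1)" "deg_lt (layer e 1 g) e"
    using deg_lt_layer[of e 0 g] deg_lt_layer[of e 1 g] by simp_all
  from D.span[OF assms(4) this] obtain p q where
    deg: "\<And>k. k \<in> K \<Longrightarrow> deg_lt (p k) (e + 1 - b k)" "\<And>k. k \<in> K \<Longrightarrow> deg_lt (q k) (e - b k)"
    and p: "layer e 0 g = (\<Sum>k\<in>K. lin (of_nat k) ^ b k * p k)"
    and q: "layer e 1 g = (\<Sum>k\<in>K. lin (of_nat k) ^ b k * q k +
        smult (of_nat (b k) * D.c k) (lin (of_nat k) ^ (b k - 1) * p k))"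
    by blast
  define w where "w k = from_layers (e - b k) (p k) (q k)" for k
  have kw: "Poly_Mapping.keys (w k) \<subseteq> reduced_mons e b k" if "k \<in> K" for k
    using keys_from_layers[of "e - b k" "p k" "q k"] D.a_le[OF that]
    by (auto simp: w_def reduced_mons_def of_nat_diff)
  have lw: "layer (e - b k) 0 (w k) = p k" "layer (e - b k) 1 (w k) = q k" if "k \<in> K" for k
    unfolding w_def using deg[OF that] D.a_le[OF that]
    by (intro layer_from_layers; simp add: Suc_diff_le)+
  define R where "R = g - (\<Sum>k\<in>K. line (special D.c) k ^ b k * w k)"
  have "R \<in> Rdeg (int e)" unfolding R_def
    by (intro Rdeg_diff Rdeg_sum g power_mult_Rdeg kw)
  moreover have "layer e 0 R = 0" "layer e 1 R = 0"
  proof -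
    have g: "g = R + (\<Sum>k\<in>K. line (special D.c) k ^ b k * w k)" by (simp add: R_def)
    show "layer e 0 R = 0"
      using p unfolding g layer_add layer_sum using pos D.a_le lw by (simp add: layer_special)
    show "layer e 1 R = 0"
      using q unfolding g layer_add layer_sum using pos D.a_le lw
      by (simp add: layer_special(2)[unfolded One_nat_def])
  qed
  ultimately obtain r where r: "r \<in> Rdeg (int e - 2)" "R = line (special D.c) 0 ^ 2 * r"
    using square_special_factor lookup_eq_0_of_layers by metis
  define w' where "w' = w(0 := r)"
  have "(\<Sum>k\<in>insert 0 K. line (special D.c) k ^ b k * w' k) = R + (\<Sum>k\<in>K. line (special D.c) k ^ b k * w k)"
    using assms(2,3) D.finite_K r by (simp add: w'_def) (intro sum.cong, auto)
  also have "\<dots> = g" by (simp add: R_def)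
  finally have "g = (\<Sum>k\<in>insert 0 K. line (special D.c) k ^ b k * w' k)" ..
  moreover have "\<forall>k\<in>insert 0 K. Poly_Mapping.keys (w' k) \<subseteq> reduced_mons e b k"
    using kw r assms(3) by (auto simp: w'_def reduced_mons_def Rdeg_iff subset_iff)
  ultimately show ?thesis by blast
qed

section \<open>Maximal rank in general position\<close>

lemma ex_double_line_pairs:
  assumes "finite K" "\<forall>k\<in>K. 1 \<le> b k \<and> b k \<le> e"
  obtains A where "double_line_pairs (of_nat :: nat \<Rightarrow> 'a::field_char_0) b e K A"
proof -
  obtain A where "A \<subseteq> K" "card A = min (card K) (e + 1 - (\<Sum>k\<in>K. e - b k))"
    using obtain_subset_with_card_n[of "min (card K) (e + 1 - (\<Sum>k\<in>K. e - b k))" K] by auto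
  with assms have "double_line_pairs (of_nat :: nat \<Rightarrow> 'a) b e K A"
    by unfold_locales (auto intro: inj_on_of_nat)
  then show ?thesis by (rule that)
qed

lemma generically_reduced_independent:
  fixes b :: "nat \<Rightarrow> nat"
  assumes "K \<subseteq> {1..s + 1}" "\<forall>k\<in>K. 1 \<le> b k \<and> b k \<le> e" "b 0 = 2"
    and "(\<Sum>k\<in>K. 2 * (e - b k) + 1) \<le> 2 * e + 1"
  shows "generically (3 * (s + 2)) (\<lambda>v :: nat \<Rightarrow> 'a::field_char_0. \<forall>w.
    (\<forall>k\<in>insert 0 K. Poly_Mapping.keys (w k) \<subseteq> reduced_mons e b k) \<longrightarrow>
    (\<Sum>k\<in>insert 0 K. line v k ^ b k * w k) = 0 \<longrightarrow> (\<forall>k\<in>insert 0 K. w k = 0))"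
proof -
  have fin: "finite K" using assms(1) finite_subset by blast
  obtain A where A: "double_line_pairs (of_nat :: nat \<Rightarrow> 'a) b e K A"
    using ex_double_line_pairs[OF fin assms(2)] by blast
  show ?thesis
  proof (rule generically_forms_independent[where ?v0.0 = "special (double_line_pairs.c A)"])
    show "poly_fun (3 * (s + 2)) (\<lambda>v :: nat \<Rightarrow> 'a. Poly_Mapping.lookup (line v k ^ b k * Poly_Mapping.single m 1) c)"
      if "k \<in> insert 0 K" for k m c
      unfolding line_def using that assms(1) by (intro poly_fun_lookup_linform_power) auto
  next
    fix w assume "\<And>k. k \<in> insert 0 K \<Longrightarrow> Poly_Mapping.keys (w k) \<subseteq> reduced_mons e b k"
      "(\<Sum>k\<in>insert 0 K. line (special (double_line_pairs.c A)) k ^ b k * w k) = (0 :: 'a mpoly)"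
    then show "\<forall>k\<in>insert 0 K. w k = 0"
      using assms(1) by (intro special_independent[OF A _ assms(3,4)]) auto
  qed (use fin finite_reduced_mons in auto)
qed

lemma generically_reduced_span:
  fixes b :: "nat \<Rightarrow> nat"
  assumes "K \<subseteq> {1..s + 1}" "\<forall>k\<in>K. 1 \<le> b k \<and> b k \<le> e" "b 0 = 2"
    and "2 * e + 1 \<le> (\<Sum>k\<in>K. 2 * (e - b k) + 1)"
  shows "generically (3 * (s + 2)) (\<lambda>v :: nat \<Rightarrow> 'a::field_char_0. \<forall>g. Poly_Mapping.keys g \<subseteq> Mon (int e) \<longrightarrow>
    (\<exists>w. (\<forall>k\<in>insert 0 K. Poly_Mapping.keys (w k) \<subseteq> reduced_mons e b k) \<and>
      g = (\<Sum>k\<in>insert 0 K. line v k ^ b k * w k)))"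
proof -
  have fin: "finite K" using assms(1) finite_subset by blast
  obtain A where A: "double_line_pairs (of_nat :: nat \<Rightarrow> 'a) b e K A"
    using ex_double_line_pairs[OF fin assms(2)] by blast
  show ?thesis
  proof (rule generically_forms_span[where ?v0.0 = "special (double_line_pairs.c A)"])
    show "poly_fun (3 * (s + 2)) (\<lambda>v :: nat \<Rightarrow> 'a. Poly_Mapping.lookup (line v k ^ b k * Poly_Mapping.single m 1) c)"
      if "k \<in> insert 0 K" for k m c
      unfolding line_def using that assms(1) by (intro poly_fun_lookup_linform_power) auto
  next
    fix g :: "'a mpoly" assume "Poly_Mapping.keys g \<subseteq> Mon (int e)"
    then show "\<exists>w. (\<forall>k\<in>insert 0 K. Poly_Mapping.keys (w k) \<subseteq> reduced_mons e b k) \<and>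
      g = (\<Sum>k\<in>insert 0 K. line (special (double_line_pairs.c A)) k ^ b k * w k)"
      using assms(1) by (intro special_span[OF A _ assms(3,4)]) (auto simp: Rdeg_iff)
  next
    show "Poly_Mapping.keys (line v k ^ b k * w) \<subseteq> Mon (int e)"
      if "Poly_Mapping.keys w \<subseteq> reduced_mons e b k" for v :: "nat \<Rightarrow> 'a" and k w
      using power_mult_Rdeg[OF that] by (simp add: Rdeg_iff)
  qed (use fin finite_reduced_mons finite_Mon in auto)
qed

text \<open>Needed because cofactors of ideal elements in general position are not reduced, and
  reducing them modulo \<open>L_0^2\<close> leaves monomials of \<open>x\<close>-degree at most 1
  only if \<open>L_0\<close> really involves \<open>x\<close>.\<close>

lemma generically_division:
  shows "generically (3 * (s + 2)) (\<lambda>v :: nat \<Rightarrow> 'a::field_char_0. \<forall>g \<in> Rdeg (int e).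
    \<exists>r w. r \<in> Rdeg (int e - 2) \<and> Poly_Mapping.keys w \<subseteq> {m \<in> Mon (int e). Poly_Mapping.lookup m 0 \<le> 1} \<and>
      g = line v 0 ^ 2 * r + w)"
proof -
  \<comment> \<open>Exponent 0 at index 1 turns that summand into the bare cofactor
    \<open>w 1\<close>, so division with remainder becomes an instance of spanning and the openness
    lemma applies.\<close>
  define b :: "nat \<Rightarrow> nat" where "b k = (if k = 0 then 2 else 0)" for k
  have "generically (3 * (s + 2)) (\<lambda>v :: nat \<Rightarrow> 'a::field_char_0. \<forall>g. Poly_Mapping.keys g \<subseteq> Mon (int e) \<longrightarrow>
    (\<exists>w. (\<forall>k\<in>{0, 1}. Poly_Mapping.keys (w k) \<subseteq> reduced_mons e b k) \<and>
      g = (\<Sum>k\<in>{0, 1}. line v k ^ b k * w k)))"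
  proof (rule generically_forms_span[where ?v0.0 = "special (\<lambda>_. 0)"])
    show "poly_fun (3 * (s + 2)) (\<lambda>v :: nat \<Rightarrow> 'a. Poly_Mapping.lookup (line v k ^ b k * Poly_Mapping.single m 1) c)"
      if "k \<in> {0, 1}" for k m c
      unfolding line_def using that by (intro poly_fun_lookup_linform_power) auto
  next
    fix g :: "'a mpoly" assume g: "Poly_Mapping.keys g \<subseteq> Mon (int e)"
    define w where "w = combination_of (\<lambda>_::unit. reduced_mons e b 1) (\<lambda>(_, m). Poly_Mapping.lookup g m) ()"
    have kw: "Poly_Mapping.keys w \<subseteq> reduced_mons e b 1"
      unfolding w_def by (rule keys_combination_of)
    have "g - w \<in> Rdeg (int e)"
      using g reduced_mons_Rdeg[OF kw] by (intro Rdeg_diff) (simp_all add: Rdeg_iff b_def)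
    moreover have "Poly_Mapping.lookup (g - w) m = 0" if "m \<in> Mon (int e)" "Poly_Mapping.lookup m 0 \<le> 1" for m
      using that by (simp add: lookup_minus w_def lookup_combination_of finite_reduced_mons)
         (simp add: reduced_mons_def b_def lookup_combination_of finite_Mon)
    ultimately obtain r where r: "r \<in> Rdeg (int e - 2)" "g - w = line (special (\<lambda>_. 0)) 0 ^ 2 * r"
      using square_special_factor[of "g - w" e "\<lambda>_. 0"] by blast
    have "g = line (special (\<lambda>_. 0)) 0 ^ 2 * r + w" by (simp flip: r(2))
    then show "\<exists>w. (\<forall>k\<in>{0, 1}. Poly_Mapping.keys (w k) \<subseteq> reduced_mons e b k) \<and>
      g = (\<Sum>k\<in>{0, 1}. line (special (\<lambda>_. 0)) k ^ b k * w k)"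
      using r(1) kw by (intro exI[of _ "\<lambda>k. if k = 0 then r else w"])
        (auto simp: b_def reduced_mons_def Rdeg_iff)
  next
    show "Poly_Mapping.keys (line v k ^ b k * w) \<subseteq> Mon (int e)"
      if "Poly_Mapping.keys w \<subseteq> reduced_mons e b k" for v :: "nat \<Rightarrow> 'a" and k w
      using power_mult_Rdeg[OF that] by (simp add: Rdeg_iff)
  qed (use finite_reduced_mons finite_Mon in auto)
  then show ?thesis
  proof (rule generically_mono, intro ballI)
    fix v :: "nat \<Rightarrow> 'a" and g :: "'a mpoly"
    assume v: "\<forall>g. Poly_Mapping.keys g \<subseteq> Mon (int e) \<longrightarrow>
      (\<exists>w. (\<forall>k\<in>{0, 1}. Poly_Mapping.keys (w k) \<subseteq> reduced_mons e b k) \<and>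
        g = (\<Sum>k\<in>{0, 1}. line v k ^ b k * w k))" and g: "g \<in> Rdeg (int e)"
    then obtain w where "\<forall>k\<in>{0, 1}. Poly_Mapping.keys (w k) \<subseteq> reduced_mons e b k"
      "g = (\<Sum>k\<in>{0, 1}. line v k ^ b k * w k)"
      unfolding Rdeg_iff by blast
    then show "\<exists>r w. r \<in> Rdeg (int e - 2) \<and> Poly_Mapping.keys w \<subseteq> {m \<in> Mon (int e). Poly_Mapping.lookup m 0 \<le> 1} \<and>
      g = line v 0 ^ 2 * r + w"
      by (intro exI[of _ "w 0"] exI[of _ "w 1"]) (auto simp: Rdeg_iff reduced_mons_def b_def)
  qed
qed

text \<open>Cofactors in \<open>gen_ideal\<close> may be inhomogeneous. For an element of degree
  \<open>j\<close> only their parts of degree \<open>j - b k\<close> count.\<close>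

definition hom_part :: "int \<Rightarrow> 'a::comm_ring_1 mpoly \<Rightarrow> 'a mpoly" where
  "hom_part z p = (\<Sum>m\<in>{m \<in> Poly_Mapping.keys p. int (mon_deg m) = z}. Poly_Mapping.single m (Poly_Mapping.lookup p m))"

lemma lookup_hom_part:
  "Poly_Mapping.lookup (hom_part z p) m = (if int (mon_deg m) = z then Poly_Mapping.lookup p m else 0)"
  by (simp add: hom_part_def lookup_sum lookup_single when_def in_keys_iff)

lemma hom_part_sum: "hom_part z (sum f A) = (\<Sum>i\<in>A. hom_part z (f i))"
  by (intro poly_mapping_eqI) (simp add: lookup_hom_part lookup_sum)

lemma hom_part_id: "p \<in> Rdeg z \<Longrightarrow> hom_part z p = p"
  by (intro poly_mapping_eqI) (auto simp: lookup_hom_part Rdeg_def in_keys_iff)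

lemma hom_part_Rdeg: "mp_in_vars 3 p \<Longrightarrow> hom_part z p \<in> Rdeg z"
  by (auto simp: Rdeg_def mp_in_vars_def in_keys_iff lookup_hom_part split: if_splits)

lemma hom_part_linform_mult: "hom_part (z + 1) (linform u * p) = linform u * hom_part z p"
proof (rule poly_mapping_eqI)
  fix m
  have "int (mon_deg m) = z + 1 \<longleftrightarrow> int (mon_deg (m - Poly_Mapping.single i 1)) = z"
    if "Poly_Mapping.lookup m i > 0" for i
  proof -
    have "m = (m - Poly_Mapping.single i 1) + Poly_Mapping.single i 1"
      using that by (intro poly_mapping_eqI) (auto simp: lookup_add lookup_minus lookup_single when_def)
    then have "mon_deg m = mon_deg (m - Poly_Mapping.single i 1) + 1"
      by (metis mon_deg_add mon_deg_single)
    then show ?thesis by simp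
  qed
  then show "Poly_Mapping.lookup (hom_part (z + 1) (linform u * p)) m = Poly_Mapping.lookup (linform u * hom_part z p) m"
    unfolding lookup_hom_part lookup_linform_mult
    by (auto intro!: sum.cong sum.neutral simp del: One_nat_def)
qed

lemma hom_part_linform_power_mult: "hom_part (z + int n) (linform u ^ n * p) = linform u ^ n * hom_part z p"
proof (induction n)
  case (Suc n)
  have "hom_part (z + int (Suc n)) (linform u ^ Suc n * p) = hom_part (z + int n + 1) (linform u * (linform u ^ n * p))"
    by (simp add: mult.assoc add_ac)
  then show ?case unfolding hom_part_linform_mult Suc by (simp add: mult.assoc)
qed simp

section \<open>Membership in the ideal\<close>

lemma gen_idealI:
  "p = (\<Sum>k\<le>s. r k * g k) \<Longrightarrow> (\<And>k. k \<le> s \<Longrightarrow> mp_in_vars 3 (r k)) \<Longrightarrow> p \<in> gen_ideal s g"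
  unfolding gen_ideal_def by blast

lemma gen_ideal_mult:
  assumes "p \<in> gen_ideal s g" "mp_in_vars 3 q"
  shows "q * p \<in> gen_ideal s g"
proof -
  obtain r where r: "p = (\<Sum>k\<le>s. r k * g k)" "\<forall>k\<le>s. mp_in_vars 3 (r k)"
    using assms(1) by (auto simp: gen_ideal_def)
  then have "q * p = (\<Sum>k\<le>s. (q * r k) * g k)" by (simp add: sum_distrib_left mult.assoc)
  then show ?thesis by (rule gen_idealI) (simp add: r(2) assms(2) mp_in_vars_mult)
qed

lemma gen_ideal_add:
  assumes "p \<in> gen_ideal s g" "q \<in> gen_ideal s g"
  shows "p + q \<in> gen_ideal s g"
proof -
  obtain r r' where "p = (\<Sum>k\<le>s. r k * g k)" "\<forall>k\<le>s. mp_in_vars 3 (r k)"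
    "q = (\<Sum>k\<le>s. r' k * g k)" "\<forall>k\<le>s. mp_in_vars 3 (r' k)"
    using assms by (auto simp: gen_ideal_def)
  then have "p + q = (\<Sum>k\<le>s. (r k + r' k) * g k)" "\<And>k. k \<le> s \<Longrightarrow> mp_in_vars 3 (r k + r' k)"
    by (auto simp: sum.distrib distrib_right mp_in_vars_add)
  then show ?thesis by (rule gen_idealI)
qed

lemma gen_ideal_0: "0 \<in> gen_ideal s g"
  by (rule gen_idealI[of _ "\<lambda>_. 0"]) simp_all

lemma gen_ideal_sum: "(\<And>i. i \<in> A \<Longrightarrow> f i \<in> gen_ideal s g) \<Longrightarrow> sum f A \<in> gen_ideal s g"
  by (induction A rule: infinite_finite_induct) (auto intro: gen_ideal_0 gen_ideal_add)

lemma gen_ideal_combination: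
  assumes "K \<subseteq> {..s}" "\<And>k. k \<in> K \<Longrightarrow> mp_in_vars 3 (r k)"
  shows "(\<Sum>k\<in>K. g k * r k) \<in> gen_ideal s g"
proof -
  have "(\<Sum>k\<in>K. g k * r k) = (\<Sum>k\<le>s. (if k \<in> K then r k else 0) * g k)"
    using assms(1) by (intro sum.mono_neutral_cong_left) (auto simp: mult.commute)
  then show ?thesis by (rule gen_idealI) (simp add: assms(2))
qed

text \<open>A monomial of positive degree is a variable times a monomial of one degree less, so
  vanishing of the quotient in one degree propagates upwards.\<close>

lemma Rdeg_subset_gen_ideal:
  fixes g :: "nat \<Rightarrow> 'a::comm_ring_1 mpoly"
  assumes "Rdeg (int e) \<subseteq> gen_ideal s g" "int e \<le> z"
  shows "Rdeg z \<subseteq> gen_ideal s g"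
  using assms(2)
proof (induction z rule: int_ge_induct)
  case base
  show ?case by (fact assms(1))
next
  case (step z)
  show ?case
  proof
    fix p :: "'a mpoly" assume p: "p \<in> Rdeg (z + 1)"
    have "Poly_Mapping.single m c \<in> gen_ideal s g" if "m \<in> Mon (z + 1)" for m and c :: 'a
    proof -
      have "Poly_Mapping.keys m \<noteq> {}" using that step(1) by (auto simp: Mon_def mon_deg_def)
      then obtain i where i: "i \<in> Poly_Mapping.keys m" by blast
      define n where "n = m - Poly_Mapping.single i 1"
      have mn: "m = Poly_Mapping.single i 1 + n"
        using i by (intro poly_mapping_eqI) (auto simp: n_def lookup_add lookup_minus lookup_single when_def in_keys_iff)
      have "Poly_Mapping.keys n \<subseteq> Poly_Mapping.keys m"
        by (auto simp: n_def in_keys_iff lookup_minus)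
      moreover have "mon_deg m = mon_deg n + 1" unfolding mn by (simp add: mon_deg_add)
      ultimately have "Poly_Mapping.single n c \<in> Rdeg z" using that by (auto simp: Rdeg_iff Mon_def)
      moreover have "i < 3" using i that by (auto simp: Mon_def)
      ultimately have "Poly_Mapping.single (Poly_Mapping.single i 1) 1 * Poly_Mapping.single n c \<in> gen_ideal s g"
        using step.IH by (intro gen_ideal_mult mp_in_vars_single) auto
      then show ?thesis unfolding mn mult_single by simp
    qed
    then show "p \<in> gen_ideal s g"
      using p by (subst mpoly_expansion[OF finite_keys subset_refl, of p])
        (rule gen_ideal_sum, auto simp: Rdeg_iff)
  qed
qed

text \<open>Line \<open>s + 1\<close> is not a generator of the ideal: its cofactor is the required
  preimage, and the other summands lie in the ideal.\<close>

lemma mult_surj_of_span: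
  fixes v :: "nat \<Rightarrow> 'a::field_char_0"
  assumes span: "\<forall>g. Poly_Mapping.keys g \<subseteq> Mon (int j) \<longrightarrow>
      (\<exists>w. (\<forall>k\<in>insert 0 K. Poly_Mapping.keys (w k) \<subseteq> reduced_mons j b k) \<and>
        g = (\<Sum>k\<in>insert 0 K. line v k ^ b k * w k))"
    and K: "finite K" "K \<subseteq> {1..s + 1}" "s + 1 \<in> K"
  shows "mult_surj (gen_ideal s (\<lambda>k. line v k ^ b k)) (line v (s + 1) ^ b (s + 1)) (int (b (s + 1))) (int j)"
  unfolding mult_surj_def
proof
  fix g :: "'a mpoly" assume "g \<in> Rdeg (int j)"
  then obtain w where w: "\<forall>k\<in>insert 0 K. Poly_Mapping.keys (w k) \<subseteq> reduced_mons j b k"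
    "g = (\<Sum>k\<in>insert 0 K. line v k ^ b k * w k)"
    using span unfolding Rdeg_iff by blast
  have Rw: "w k \<in> Rdeg (int j - int (b k))" if "k \<in> insert 0 K" for k
    using w(1) that by (intro reduced_mons_Rdeg) auto
  have "g - line v (s + 1) ^ b (s + 1) * w (s + 1) = (\<Sum>k\<in>insert 0 K - {s + 1}. line v k ^ b k * w k)"
    unfolding w(2) using K by (subst sum.remove[of _ "s + 1"]) auto
  also have "\<dots> \<in> gen_ideal s (\<lambda>k. line v k ^ b k)"
  proof (rule gen_ideal_combination)
    show "insert 0 K - {s + 1} \<subseteq> {..s}" using K(2) by force
  qed (use Rw Rdeg_in_vars in blast)
  finally show "\<exists>f\<in>Rdeg (int j - int (b (s + 1))).
      g - line v (s + 1) ^ b (s + 1) * f \<in> gen_ideal s (\<lambda>k. line v k ^ b k)"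
    using Rw K(3) by blast
qed

text \<open>Membership of \<open>L^d f\<close> in the ideal is a relation among all the lines, with
  \<open>f\<close> as cofactor of line \<open>s + 1\<close>. Reducing the cofactors modulo
  \<open>L_0^2\<close> makes independence applicable; the reduced part of \<open>f\<close> then
  vanishes, so \<open>f\<close> is a multiple of \<open>L_0^2\<close>.\<close>

lemma mult_inj_of_independent:
  fixes v :: "nat \<Rightarrow> 'a::field_char_0"
  assumes ind: "\<forall>w. (\<forall>k\<in>insert 0 K. Poly_Mapping.keys (w k) \<subseteq> reduced_mons j b k) \<longrightarrow>
      (\<Sum>k\<in>insert 0 K. line v k ^ b k * w k) = 0 \<longrightarrow> (\<forall>k\<in>insert 0 K. w k = 0)"
    and division: "\<And>e. e \<le> j \<Longrightarrow> \<forall>g \<in> Rdeg (int e).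
      \<exists>r w. r \<in> Rdeg (int e - 2) \<and> Poly_Mapping.keys w \<subseteq> {m \<in> Mon (int e). Poly_Mapping.lookup m 0 \<le> 1} \<and>
        g = line v 0 ^ 2 * r + w"
    and K: "K = {k \<in> {1..s + 1}. b k \<le> j}" "s + 1 \<in> K" and b0: "b 0 = 2"
  shows "mult_inj (gen_ideal s (\<lambda>k. line v k ^ b k)) (line v (s + 1) ^ b (s + 1)) (int (b (s + 1))) (int j)"
  unfolding mult_inj_def
proof (intro ballI impI)
  fix f :: "'a mpoly"
  assume f: "f \<in> Rdeg (int j - int (b (s + 1)))"
    and "line v (s + 1) ^ b (s + 1) * f \<in> gen_ideal s (\<lambda>k. line v k ^ b k)"
  then obtain r where r: "line v (s + 1) ^ b (s + 1) * f = (\<Sum>k\<le>s. r k * line v k ^ b k)"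
    "\<forall>k\<le>s. mp_in_vars 3 (r k)"
    unfolding gen_ideal_def by blast
  define \<rho> where "\<rho> k = hom_part (int j - int (b k)) (r k)" for k
  have \<rho>: "\<rho> k \<in> Rdeg (int j - int (b k))" if "k \<le> s" for k
    unfolding \<rho>_def using r(2) that by (intro hom_part_Rdeg) auto
  have fin: "finite K" using K(1) by simp
  have "line v (s + 1) ^ b (s + 1) * f \<in> Rdeg (int j)"
    using Rdeg_mult[OF linform_power_Rdeg f, of _ "b (s + 1)"] by (simp add: line_def)
  then have "line v (s + 1) ^ b (s + 1) * f = hom_part (int j) (\<Sum>k\<le>s. line v k ^ b k * r k)"
    using r(1) by (simp add: hom_part_id mult.commute)
  also have "\<dots> = (\<Sum>k\<le>s. line v k ^ b k * \<rho> k)"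
    unfolding hom_part_sum \<rho>_def line_def
  proof (intro sum.cong refl)
    fix k
    show "hom_part (int j) (linform (\<lambda>i. v (3 * k + i)) ^ b k * r k) =
        linform (\<lambda>i. v (3 * k + i)) ^ b k * hom_part (int j - int (b k)) (r k)"
      using hom_part_linform_power_mult[of "int j - int (b k)" "b k" "\<lambda>i. v (3 * k + i)" "r k"] by simp
  qed
  also have "\<dots> = (\<Sum>k\<in>insert 0 K - {s + 1}. line v k ^ b k * \<rho> k)"
  \<comment> \<open>Generators of degree above \<open>j\<close> drop out, since their homogeneous
    cofactors have negative degree.\<close>
  proof (rule sum.mono_neutral_right)
    show "insert 0 K - {s + 1} \<subseteq> {..s}" unfolding K(1) by force
    show "\<forall>k\<in>{..s} - (insert 0 K - {s + 1}). line v k ^ b k * \<rho> k = 0"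
    proof
      fix k assume "k \<in> {..s} - (insert 0 K - {s + 1})"
      then have "k \<le> s" "int j - int (b k) < 0" unfolding K(1) by auto
      then have "\<rho> k = 0" using \<rho> Rdeg_neg by blast
      then show "line v k ^ b k * \<rho> k = 0" by simp
    qed
  qed simp
  finally have eq: "line v (s + 1) ^ b (s + 1) * f = (\<Sum>k\<in>insert 0 K - {s + 1}. line v k ^ b k * \<rho> k)" .
  define h where "h k = (if k = s + 1 then f else - \<rho> k)" for k
  have h: "h k \<in> Rdeg (int j - int (b k))" if "k \<in> insert 0 K" for k
    using that f \<rho>[of k] Rdeg_uminus unfolding h_def K(1) by auto
  have sum_h: "(\<Sum>k\<in>insert 0 K. line v k ^ b k * h k) = 0"
  proof -
    have "(\<Sum>k\<in>insert 0 K. line v k ^ b k * h k) = line v (s + 1) ^ b (s + 1) * f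
        + (\<Sum>k\<in>insert 0 K - {s + 1}. - (line v k ^ b k * \<rho> k))"
      using K(2) fin by (subst sum.remove[of _ "s + 1"]) (auto simp: h_def intro!: sum.cong)
    then show ?thesis unfolding eq by (simp add: sum_negf)
  qed
  have "\<exists>q w. q \<in> Rdeg (int j - int (b k) - 2) \<and> Poly_Mapping.keys w \<subseteq> reduced_mons j b k \<and>
      h k = line v 0 ^ 2 * q + w" if k: "k \<in> K" for k
  proof -
    have "b k \<le> j" "k > 0" using k unfolding K(1) by auto
    then show ?thesis
      using division[of "j - b k"] h[of k] k unfolding reduced_mons_def by (auto simp: of_nat_diff)
  qed
  then obtain q w where q: "\<And>k. k \<in> K \<Longrightarrow> q k \<in> Rdeg (int j - int (b k) - 2)"
    and w: "\<And>k. k \<in> K \<Longrightarrow> Poly_Mapping.keys (w k) \<subseteq> reduced_mons j b k"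
    and hw: "\<And>k. k \<in> K \<Longrightarrow> h k = line v 0 ^ 2 * q k + w k"
    by metis
  have K0: "0 \<notin> K" unfolding K(1) by simp
  \<comment> \<open>The quotients \<open>q k\<close> are moved from line \<open>k\<close> to the
    generator \<open>L_0^2\<close>, whose cofactor may be any form of degree \<open>j - 2\<close>.
    This leaves the sum unchanged.\<close>
  define w0 where "w0 = h 0 + (\<Sum>k\<in>K. line v k ^ b k * q k)"
  define w' where "w' = w(0 := w0)"
  have "w0 \<in> Rdeg (int j - 2)" unfolding w0_def
  proof (intro Rdeg_add Rdeg_sum)
    show "h 0 \<in> Rdeg (int j - 2)" using h[of 0] b0 by simp
    fix k assume "k \<in> K"
    then show "line v k ^ b k * q k \<in> Rdeg (int j - 2)"
      using Rdeg_mult[OF linform_power_Rdeg[of "\<lambda>i. v (3 * k + i)" "b k"] q[of k]] by (simp add: line_def)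
  qed
  then have "\<forall>k\<in>insert 0 K. Poly_Mapping.keys (w' k) \<subseteq> reduced_mons j b k"
    using w b0 by (auto simp: w'_def reduced_mons_def Rdeg_iff subset_iff)
  moreover have "(\<Sum>k\<in>insert 0 K. line v k ^ b k * w' k) = 0"
  proof -
    have "(\<Sum>k\<in>insert 0 K. line v k ^ b k * w' k) = line v 0 ^ 2 * w0 + (\<Sum>k\<in>K. line v k ^ b k * w k)"
      using K0 fin b0 by (simp add: w'_def) (intro sum.cong, auto)
    also have "\<dots> = line v 0 ^ 2 * h 0 + (\<Sum>k\<in>K. line v k ^ b k * (line v 0 ^ 2 * q k + w k))"
      by (simp add: w0_def distrib_left sum.distrib sum_distrib_left mult.left_commute)
    also have "\<dots> = (\<Sum>k\<in>insert 0 K. line v k ^ b k * h k)"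
      using K0 fin b0 by (simp add: hw)
    finally show ?thesis using sum_h by simp
  qed
  ultimately have "w' (s + 1) = 0" using ind K(2) by blast
  then have "f = line v 0 ^ 2 * q (s + 1)"
    using hw[OF K(2)] K0 K(2) by (simp add: h_def w'_def)
  also have "\<dots> = (\<Sum>k\<in>{0}. line v k ^ b k * q (s + 1))" using b0 by simp
  also have "\<dots> \<in> gen_ideal s (\<lambda>k. line v k ^ b k)"
    using q[OF K(2)] Rdeg_in_vars by (intro gen_ideal_combination) auto
  finally show "f \<in> gen_ideal s (\<lambda>k. line v k ^ b k)" .
qed

lemma gen_ideal_cong: "(\<And>k. k \<le> s \<Longrightarrow> g k = h k) \<Longrightarrow> gen_ideal s g = gen_ideal s h"
  unfolding gen_ideal_def by (metis (mono_tags, lifting) atMost_iff sum.cong)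

lemma generically_max_rank:
  fixes b :: "nat \<Rightarrow> nat"
  assumes b: "b 0 = 2" "\<forall>k\<in>{1..s}. 1 \<le> b k" and d: "1 \<le> d" "d \<le> j"
  shows "generically (3 * (s + 2)) (\<lambda>v :: nat \<Rightarrow> 'a::field_char_0.
    max_rank (gen_ideal s (\<lambda>k. line v k ^ b k)) (line v (s + 1) ^ d) (int d) (int j))"
proof -
  \<comment> \<open>\<open>L\<close> joins the lines as number \<open>s + 1\<close>, with exponent
    \<open>d\<close>. The generators stop at \<open>s\<close>, so the ideal is unaffected.\<close>
  define c where "c = b(s + 1 := d)"
  define K where "K = {k \<in> {1..s + 1}. c k \<le> j}"
  have c: "c (s + 1) = d" "c 0 = 2" using b(1) by (auto simp: c_def)
  have K: "K \<subseteq> {1..s + 1}" "finite K" "s + 1 \<in> K" "\<forall>k\<in>K. 1 \<le> c k \<and> c k \<le> j"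
    using b(2) d by (auto simp: K_def c_def)
  have I: "gen_ideal s (\<lambda>k. line v k ^ b k) = gen_ideal s (\<lambda>k. line v k ^ c k)" for v :: "nat \<Rightarrow> 'a"
    by (rule gen_ideal_cong) (simp add: c_def)
  show ?thesis
  proof (cases "(\<Sum>k\<in>K. 2 * (j - c k) + 1) \<le> 2 * j + 1")
    case True
    \<comment> \<open>The cofactor of line \<open>k\<close> has degree \<open>j - c k\<close>, so
      division is requested in all of the finitely many degrees up to \<open>j\<close>.\<close>
    have "generically (3 * (s + 2)) (\<lambda>v :: nat \<Rightarrow> 'a. \<forall>e\<in>{..j}. \<forall>g \<in> Rdeg (int e).
      \<exists>r w. r \<in> Rdeg (int e - 2) \<and> Poly_Mapping.keys w \<subseteq> {m \<in> Mon (int e). Poly_Mapping.lookup m 0 \<le> 1} \<and>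
        g = line v 0 ^ 2 * r + w)"
      by (intro generically_Ball generically_division) simp
    from generically_conj[OF generically_reduced_independent[OF K(1,4) c(2) True] this] show ?thesis
    proof (rule generically_mono)
      fix v :: "nat \<Rightarrow> 'a"
      assume *: "(\<forall>w. (\<forall>k\<in>insert 0 K. Poly_Mapping.keys (w k) \<subseteq> reduced_mons j c k) \<longrightarrow>
        (\<Sum>k\<in>insert 0 K. line v k ^ c k * w k) = 0 \<longrightarrow> (\<forall>k\<in>insert 0 K. w k = 0)) \<and>
        (\<forall>e\<in>{..j}. \<forall>g \<in> Rdeg (int e).
        \<exists>r w. r \<in> Rdeg (int e - 2) \<and> Poly_Mapping.keys w \<subseteq> {m \<in> Mon (int e). Poly_Mapping.lookup m 0 \<le> 1} \<and>
          g = line v 0 ^ 2 * r + w)"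
      have "mult_inj (gen_ideal s (\<lambda>k. line v k ^ c k)) (line v (s + 1) ^ c (s + 1)) (int (c (s + 1))) (int j)"
        by (rule mult_inj_of_independent[OF conjunct1[OF *] _ K_def K(3) c(2)])
           (use conjunct2[OF *] in blast)
      then show "max_rank (gen_ideal s (\<lambda>k. line v k ^ b k)) (line v (s + 1) ^ d) (int d) (int j)"
        unfolding max_rank_def I c(1) by blast
    qed
  next
    case False
    then have "2 * j + 1 \<le> (\<Sum>k\<in>K. 2 * (j - c k) + 1)" by linarith
    from generically_reduced_span[OF K(1,4) c(2) this] show ?thesis
    proof (rule generically_mono)
      fix v :: "nat \<Rightarrow> 'a"
      assume *: "\<forall>g. Poly_Mapping.keys g \<subseteq> Mon (int j) \<longrightarrow>
        (\<exists>w. (\<forall>k\<in>insert 0 K. Poly_Mapping.keys (w k) \<subseteq> reduced_mons j c k) \<and>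
          g = (\<Sum>k\<in>insert 0 K. line v k ^ c k * w k))"
      show "max_rank (gen_ideal s (\<lambda>k. line v k ^ b k)) (line v (s + 1) ^ d) (int d) (int j)"
        using mult_surj_of_span[OF * K(2,1,3)] unfolding max_rank_def I c(1) by blast
    qed
  qed
qed

lemma generically_Rdeg_subset_gen_ideal:
  fixes b :: "nat \<Rightarrow> nat"
  assumes "2 \<le> s" "b 0 = 2" "\<forall>k\<in>{1..s}. 1 \<le> b k"
  shows "generically (3 * (s + 2)) (\<lambda>v :: nat \<Rightarrow> 'a::field_char_0.
    Rdeg (int (b 1 + b 2)) \<subseteq> gen_ideal s (\<lambda>k. line v k ^ b k))"
proof -
  let ?e = "b 1 + b 2"
  have K: "{1, 2} \<subseteq> {1..s + 1}" "\<forall>k\<in>{1, 2}. 1 \<le> b k \<and> b k \<le> ?e"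
    using assms(1,3) by auto
  have "2 * ?e + 1 \<le> (\<Sum>k\<in>{1, 2}. 2 * (?e - b k) + 1)" by simp
  from generically_reduced_span[OF K assms(2) this] show ?thesis
  proof (rule generically_mono, intro subsetI)
    fix v :: "nat \<Rightarrow> 'a" and g :: "'a mpoly"
    assume *: "\<forall>g. Poly_Mapping.keys g \<subseteq> Mon (int ?e) \<longrightarrow>
        (\<exists>w. (\<forall>k\<in>insert 0 {1, 2}. Poly_Mapping.keys (w k) \<subseteq> reduced_mons ?e b k) \<and>
          g = (\<Sum>k\<in>insert 0 {1, 2}. line v k ^ b k * w k))" and "g \<in> Rdeg (int ?e)"
    then obtain w where w: "\<forall>k\<in>insert 0 {1, 2}. Poly_Mapping.keys (w k) \<subseteq> reduced_mons ?e b k"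
      "g = (\<Sum>k\<in>insert 0 {1, 2}. line v k ^ b k * w k)"
      unfolding Rdeg_iff by blast
    have "mp_in_vars 3 (w k)" if "k \<in> insert 0 {1, 2}" for k
      using w(1) that reduced_mons_Rdeg Rdeg_in_vars by blast
    then show "g \<in> gen_ideal s (\<lambda>k. line v k ^ b k)"
      unfolding w(2) using assms(1) by (intro gen_ideal_combination) auto
  qed
qed

theorem theorem7p1:
  fixes s :: nat and a :: "nat \<Rightarrow> nat"
  assumes "s \<ge> 2" and "\<forall>k\<in>{1..s}. a k > 0"
  shows "\<exists>P :: ('a::field_char_0) mpoly. P \<noteq> 0 \<and> mp_in_vars (3 * (s + 2)) P \<and>
    (\<forall>v. mp_eval P v \<noteq> 0 \<longrightarrow>
      (let Lk = (\<lambda>k. linform (\<lambda>i. v (3 * k + i)));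
           L = linform (\<lambda>i. v (3 * (s + 1) + i));
           I = gen_ideal s (\<lambda>k. if k = 0 then Lk 0 ^ 2 else Lk k ^ a k)
       in \<forall>d j. d \<ge> 1 \<longrightarrow> max_rank I (L ^ nat d) d j))"
proof -
  define b where "b = a(0 := 2)"
  define J where "J = b 1 + b 2"
  define I where "I v = gen_ideal s (\<lambda>k. line v k ^ b k)" for v :: "nat \<Rightarrow> 'a"
  have b: "b 0 = 2" "\<forall>k\<in>{1..s}. 1 \<le> b k"
    using assms(2) by (auto simp: b_def Suc_le_eq)
  \<comment> \<open>The pairs with \<open>1 \<le> d \<le> j < J\<close> are finite in number, so
    their open conditions can be intersected.\<close>
  define S where "S = Sigma {..<J} (\<lambda>j. {1..j})"
  have "generically (3 * (s + 2)) (\<lambda>v :: nat \<Rightarrow> 'a. \<forall>p\<in>S.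
      max_rank (I v) (line v (s + 1) ^ snd p) (int (snd p)) (int (fst p)))"
    unfolding I_def by (intro generically_Ball generically_max_rank b) (auto simp: S_def)
  from generically_conj[OF this generically_Rdeg_subset_gen_ideal[OF assms(1) b]]
  have "generically (3 * (s + 2)) (\<lambda>v :: nat \<Rightarrow> 'a. \<forall>d j. d \<ge> 1 \<longrightarrow> max_rank (I v) (line v (s + 1) ^ nat d) d j)"
  proof (rule generically_mono, intro allI impI)
    fix v :: "nat \<Rightarrow> 'a" and d j :: int
    assume v: "(\<forall>p\<in>S. max_rank (I v) (line v (s + 1) ^ snd p) (int (snd p)) (int (fst p))) \<and>
        Rdeg (int (b 1 + b 2)) \<subseteq> gen_ideal s (\<lambda>k. line v k ^ b k)" and d: "d \<ge> 1"
    \<comment> \<open>For \<open>j < d\<close> the source is zero and the map injective; from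
      \<open>J\<close> on the target is zero and the map surjective. Only the middle range uses the
      generic conditions indexed by \<open>S\<close>.\<close>
    consider "j < d" | "d \<le> j" "j < int J" | "int J \<le> j" by linarith
    then show "max_rank (I v) (line v (s + 1) ^ nat d) d j"
    proof cases
      case 1
      have "f \<in> I v" if "f \<in> Rdeg (j - d)" for f
        using Rdeg_neg[OF _ that] 1 by (simp add: I_def gen_ideal_0)
      then have "mult_inj (I v) (line v (s + 1) ^ nat d) d j"
        unfolding mult_inj_def by blast
      then show ?thesis by (simp add: max_rank_def)
    next
      case 2
      then have "(nat j, nat d) \<in> S" using d by (auto simp: S_def)
      then have "max_rank (I v) (line v (s + 1) ^ nat d) (int (nat d)) (int (nat j))"
        using bspec[OF conjunct1[OF v]] by (metis fst_conv snd_conv)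
      then show ?thesis using d 2 by simp
    next
      case 3
      then have "Rdeg j \<subseteq> I v"
        unfolding I_def J_def by (rule Rdeg_subset_gen_ideal[OF conjunct2[OF v]])
      then have "\<forall>g\<in>Rdeg j. g - line v (s + 1) ^ nat d * 0 \<in> I v"
        by (simp add: subset_iff)
      then have "mult_surj (I v) (line v (s + 1) ^ nat d) d j"
        unfolding mult_surj_def using Rdeg_0 by blast
      then show ?thesis by (simp add: max_rank_def)
    qed
  qed
  moreover have "I v = gen_ideal s (\<lambda>k. if k = 0 then line v 0 ^ 2 else line v k ^ a k)" for v
    unfolding I_def by (rule gen_ideal_cong) (simp add: b_def)
  ultimately show ?thesis
    unfolding generically_def line_def Let_def by simp
qed

end
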